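(* Let $f:\mathbb R^n\to\mathbb R$ be convex with locally Lipschitz continuous gradient, let $g:\mathbb R^n\to\mathbb R\cup\{\infty\}$ be proper, lsc and convex, and suppose that $\varphi:=f+g$ satisfies $\operatorname{argmin}\varphi\neq\emptyset$. Let $(x^k)$ and $(\gamma_k)$ be generated as follows: given $x^{-1}\in\mathbb R^n$ and $\gamma_0\ge\gamma_{-1}>0$, set $x^0=\operatorname{prox}_{\gamma_0 g}(x^{-1}-\gamma_0\nabla f(x^{-1}))$ and, for $k=0,1,2,\dots$, $$\gamma_{k+1}=\gamma_k\min\left\{\sqrt{1+\tfrac{\gamma_k}{\gamma_{k-1}}},\ \frac{1}{2\sqrt{[\gamma_k\ell_k(\gamma_kc_k-1)]_+}}\right\},\qquad x^{k+1}=\operatorname{prox}_{\gamma_{k+1}g}\bigl(x^k-\gamma_{k+1}\nabla f(x^k)\bigr),$$ with $\ell_k,c_k$ as defined in the context. Let $\rho_k:=\gamma_k/\gamma_{k-1}$, $P_k:=\varphi(x^k)-\min\varphi$, and for $x^\star\in\operatorname{argmin}\varphi$ let $$\mathcal U_k(x^\star):=\tfrac12\|x^k-x^\star\|^2+\tfrac14\|x^k-x^{k-1}\|^2+\gamma_k(1+\rho_k)P_{k-1}.$$ Then, for any $x^\star\in\operatorname{argmin}\varphi$, the following hold. (i) For all $k\ge1$, $$\mathcal U_{k+1}(x^\star)\le\mathcal U_k(x^\star)-\Bigl(\tfrac14-\rho_{k+1}^2\gamma_k\ell_k(\gamma_kc_k-1)\Bigr)\|x^{k-1}-x^k\|^2-\gamma_k\bigl(1+\rho_k-\rho_{k+1}^2\bigr)P_{k-1},$$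 where $\tfrac14-\rho_{k+1}^2\gamma_k\ell_k(\gamma_kc_k-1)\ge0$ and $1+\rho_k-\rho_{k+1}^2\ge0$. (ii) The sequence $(x^k)$ is bounded, and $\gamma_k>\frac1{2L_{f,\mathcal V}}$ holds for every $k\ge k_0:=\bigl\lfloor2\log_2\frac{1}{2\gamma_0L_{f,\mathcal V}}\bigr\rfloor_+$, where $L_{f,\mathcal V}$ is a Lipschitz modulus for $\nabla f$ on a compact convex set $\mathcal V$ containing the sequence $(x^k)$. (iii) The sequence $(x^k)$ converges to a point of $\operatorname{argmin}\varphi$. This remains true if the stepsizes are chosen in such a way that the update formula for $\gamma_{k+1}$ above holds with "$\le$" in place of "$=$", as long as $(\gamma_k)$ is bounded away from zero. (iv) The following rate holds: $$\min_{k=0,1,\dots,K}\bigl(\varphi(x^k)-\min\varphi\bigr)\le\frac{\mathcal U_1(x^\star)}{\sum_{k=1}^{K+1}\gamma_k},$$ which, by (ii), implies a sublinear $\mathcal O(1/K)$ convergence rate on the best-so-far cost.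
   Context: Norms and inner products are Euclidean. A differentiable $f:\mathbb R^n\to\mathbb R$ has locally Lipschitz continuous gradient if for every convex compact set $\mathcal V\subset\mathbb R^n$ there is $L_{f,\mathcal V}>0$ (called a Lipschitz modulus for $\nabla f$ on $\mathcal V$) with $\|\nabla f(x)-\nabla f(x')\|\le L_{f,\mathcal V}\|x-x'\|$ for all $x,x'\in\mathcal V$. For $\tau>0$, $\operatorname{prox}_{\tau g}(x):=\operatorname{argmin}_{w}\{g(w)+\frac1{2\tau}\|w-x\|^2\}$. $[r]_+:=\max\{r,0\}$ and $\lfloor r\rfloor_+:=\max\{\lfloor r\rfloor,0\}$. The local estimates are $$\ell_k:=\frac{\langle\nabla f(x^{k-1})-\nabla f(x^k),x^{k-1}-x^k\rangle}{\|x^{k-1}-x^k\|^2},\qquad c_k:=\frac{\|\nabla f(x^{k-1})-\nabla f(x^k)\|^2}{\langle\nabla f(x^{k-1})-\nabla f(x^k),x^{k-1}-x^k\rangle},$$ with the conventions $\frac00=0$ and $\frac10=\infty$.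
   Formalization: In (ii) the bound is stated for every k > k_0 instead of k ≥ k_0, since it can fail at k = k_0 (f(x)=x²/2, g=0, γ_{-1}=γ_0=1/2, L=1 gives k_0=0 and γ_0=1/2); the sequence contained in V is read as including x^{-1}. *)

theory Defs
  imports "HOL-Analysis.Analysis" "HOL-Library.Landau_Symbols"
begin

text \<open>
  Functions into \<open>\<real> \<union> {\<infinity>}\<close> are functions into \<^typ>\<open>ereal\<close> that never take the
  value \<open>-\<infinity>\<close>; the exclusion of \<open>-\<infinity>\<close> is part of \<open>proper\<close>.
\<close>

definition proper :: "('a \<Rightarrow> ereal) \<Rightarrow> bool" where
  "proper g \<longleftrightarrow> (\<forall>w. g w \<noteq> - \<infinity>) \<and> (\<exists>w. g w \<noteq> \<infinity>)"

definition lsc :: "('a::topological_space \<Rightarrow> ereal) \<Rightarrow> bool" where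
  "lsc g \<longleftrightarrow> (\<forall>w. g w \<le> Liminf (at w) g)"

definition econvex :: "('a::real_vector \<Rightarrow> ereal) \<Rightarrow> bool" where
  "econvex g \<longleftrightarrow> (\<forall>u w t. 0 \<le> t \<and> t \<le> 1 \<longrightarrow>
     g ((1 - t) *\<^sub>R u + t *\<^sub>R w) \<le> ereal (1 - t) * g u + ereal t * g w)"

definition argmin :: "('a \<Rightarrow> ereal) \<Rightarrow> 'a set" where
  "argmin h = {w. is_arg_min h (\<lambda>_. True) w}"

text \<open>
  The proximal mapping is kept set-valued, so that \<open>z = prox\<^sub>\<tau>\<^sub>g(u)\<close> is rendered as
  \<open>z \<in> prox \<tau> g u\<close>.  For proper, lsc, convex \<open>g\<close> and \<open>\<tau> > 0\<close> the set is a singleton.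
\<close>

definition prox :: "real \<Rightarrow> ('a::real_inner \<Rightarrow> ereal) \<Rightarrow> 'a \<Rightarrow> 'a set" where
  "prox \<tau> g u = argmin (\<lambda>w. g w + ereal (1 / (2 * \<tau>) * (norm (w - u))\<^sup>2))"

definition locally_Lipschitz :: "('a::real_normed_vector \<Rightarrow> 'b::metric_space) \<Rightarrow> bool" where
  "locally_Lipschitz F \<longleftrightarrow> (\<forall>V. convex V \<and> compact V \<longrightarrow> (\<exists>L>0. L-lipschitz_on V F))"

text \<open>
  Sequences are indexed by \<^typ>\<open>int\<close> and only their values at indices \<open>\<ge> -1\<close> are relevant.
  In the two local estimates \<open>F\<close> stands for the gradient of \<open>f\<close>.  The convention
  \<open>0 / 0 = 0\<close> is that of real division; a quotient \<open>a / 0\<close> with \<open>a \<noteq> 0\<close> cannot occur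
  for \<open>ell\<close>, nor for \<open>cc\<close> if \<open>F\<close> is the gradient of a convex function
  (lemma \<open>gradient_eq_if_inner_eq_0\<close> below).
\<close>

definition ell :: "('a::real_inner \<Rightarrow> 'a) \<Rightarrow> (int \<Rightarrow> 'a) \<Rightarrow> int \<Rightarrow> real" where
  "ell F x k = inner (F (x (k - 1)) - F (x k)) (x (k - 1) - x k) / (norm (x (k - 1) - x k))\<^sup>2"

definition cc :: "('a::real_inner \<Rightarrow> 'a) \<Rightarrow> (int \<Rightarrow> 'a) \<Rightarrow> int \<Rightarrow> real" where
  "cc F x k = (norm (F (x (k - 1)) - F (x k)))\<^sup>2 / inner (F (x (k - 1)) - F (x k)) (x (k - 1) - x k)"

lemma gradient_eq_if_inner_eq_0:
  fixes f :: "'a::real_inner \<Rightarrow> real"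
  assumes cvx: "convex_on UNIV f" and grad: "\<And>u. GDERIV f u :> F u"
    and eq0: "inner (F u - F w) (u - w) = 0"
  shows "F u = F w"
proof -
  have sub: "f b \<ge> f a + inner (F a) (b - a)" for a b
  proof -
    define p where "p t = f (a + t *\<^sub>R (b - a))" for t :: real
    have p: "convex_on UNIV p"
    proof (rule convex_onI)
      fix t s r :: real assume "0 < t" "t < 1"
      have "a + ((1 - t) *\<^sub>R s + t *\<^sub>R r) *\<^sub>R (b - a)
          = (1 - t) *\<^sub>R (a + s *\<^sub>R (b - a)) + t *\<^sub>R (a + r *\<^sub>R (b - a))"
        by (simp add: algebra_simps)
      then show "p ((1 - t) *\<^sub>R s + t *\<^sub>R r) \<le> (1 - t) * p s + t * p r"
        using convex_onD[OF cvx, of t] \<open>0 < t\<close> \<open>t < 1\<close> by (simp add: p_def)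
    qed simp
    have "((\<lambda>t. f (a + t *\<^sub>R (b - a))) has_derivative (\<lambda>h. inner (h *\<^sub>R (b - a)) (F a))) (at 0)"
      by (rule has_derivative_compose[where g = f and f = "\<lambda>t. a + t *\<^sub>R (b - a)"])
        (use grad[of a] in \<open>auto intro!: derivative_eq_intros simp: gderiv_def\<close>)
    then have "(p has_real_derivative inner (F a) (b - a)) (at 0)"
      by (simp add: has_field_derivative_def p_def[abs_def] inner_commute mult.commute[of _ "inner _ _"])
    then have "p 1 - p 0 \<ge> inner (F a) (b - a) * (1 - 0)"
      by (intro convex_on_imp_above_tangent[OF p]) auto
    then show ?thesis by (simp add: p_def)
  qed
  define h where "h z = f z - inner z (F w)" for z
  have "h u \<le> h z" for z
    using sub[of w z] sub[of w u] sub[of u w] eq0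
    by (simp add: h_def algebra_simps inner_commute)
  moreover have "(h has_derivative (\<lambda>d. inner d (F u) - inner d (F w))) (at u)"
    unfolding h_def using grad[of u] by (auto intro!: derivative_eq_intros simp: gderiv_def)
  ultimately have "(\<lambda>d. inner d (F u) - inner d (F w)) = (\<lambda>d. 0)"
    by (intro differential_zero_maxmin[of u UNIV h]) auto
  then have "inner (F u - F w) (F u - F w) = 0"
    by (metis inner_diff_right)
  then show ?thesis by simp
qed

text \<open>
  The right-hand side of the stepsize update is extended real valued: division on \<^typ>\<open>ereal\<close>
  satisfies \<open>1 / 0 = \<infinity>\<close>, so the second term of the minimum is \<open>\<infinity>\<close> when the
  positive part vanishes.
\<close>

definition step_bound :: "('a::real_inner \<Rightarrow> 'a) \<Rightarrow> (int \<Rightarrow> 'a) \<Rightarrow> (int \<Rightarrow> real) \<Rightarrow> int \<Rightarrow> ereal" where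
  "step_bound F x \<gamma> k = ereal (\<gamma> k) *
     min (ereal (sqrt (1 + \<gamma> k / \<gamma> (k - 1))))
         (1 / ereal (2 * sqrt (max (\<gamma> k * ell F x k * (\<gamma> k * cc F x k - 1)) 0)))"

text \<open>The case \<open>k = -1\<close> is the initial step producing \<open>x\<^sup>0\<close>.\<close>

definition prox_grad_iterates ::
  "('a::real_inner \<Rightarrow> 'a) \<Rightarrow> ('a \<Rightarrow> ereal) \<Rightarrow> (int \<Rightarrow> 'a) \<Rightarrow> (int \<Rightarrow> real) \<Rightarrow> bool" where
  "prox_grad_iterates F g x \<gamma> \<longleftrightarrow>
     (\<forall>k\<ge>-1. x (k + 1) \<in> prox (\<gamma> (k + 1)) g (x k - \<gamma> (k + 1) *\<^sub>R F (x k)))"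

definition adaPGM ::
  "('a::real_inner \<Rightarrow> 'a) \<Rightarrow> ('a \<Rightarrow> ereal) \<Rightarrow> (int \<Rightarrow> 'a) \<Rightarrow> (int \<Rightarrow> real) \<Rightarrow> bool" where
  "adaPGM F g x \<gamma> \<longleftrightarrow> 0 < \<gamma> (-1) \<and> \<gamma> (-1) \<le> \<gamma> 0 \<and> prox_grad_iterates F g x \<gamma> \<and>
     (\<forall>k\<ge>0. ereal (\<gamma> (k + 1)) = step_bound F x \<gamma> k)"

definition relaxed_adaPGM ::
  "('a::real_inner \<Rightarrow> 'a) \<Rightarrow> ('a \<Rightarrow> ereal) \<Rightarrow> (int \<Rightarrow> 'a) \<Rightarrow> (int \<Rightarrow> real) \<Rightarrow> bool" where
  "relaxed_adaPGM F g x \<gamma> \<longleftrightarrow> 0 < \<gamma> (-1) \<and> \<gamma> (-1) \<le> \<gamma> 0 \<and> prox_grad_iterates F g x \<gamma> \<and>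
     (\<forall>k\<ge>0. ereal (\<gamma> (k + 1)) \<le> step_bound F x \<gamma> k)"

definition step_ratio :: "(int \<Rightarrow> real) \<Rightarrow> int \<Rightarrow> real" where
  "step_ratio \<gamma> k = \<gamma> k / \<gamma> (k - 1)"

definition cost_gap :: "('a \<Rightarrow> ereal) \<Rightarrow> (int \<Rightarrow> 'a) \<Rightarrow> int \<Rightarrow> ereal" where
  "cost_gap \<phi> x k = \<phi> (x k) - (INF w. \<phi> w)"

definition merit ::
  "('a::real_inner \<Rightarrow> ereal) \<Rightarrow> (int \<Rightarrow> 'a) \<Rightarrow> (int \<Rightarrow> real) \<Rightarrow> 'a \<Rightarrow> int \<Rightarrow> ereal" where
  "merit \<phi> x \<gamma> z k =
     ereal (1/2 * (norm (x k - z))\<^sup>2 + 1/4 * (norm (x k - x (k - 1)))\<^sup>2)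
     + ereal (\<gamma> k * (1 + step_ratio \<gamma> k)) * cost_gap \<phi> x (k - 1)"

end

theory Submission
  imports Defs
begin

text \<open>
  Combine three subgradient inequalities: \<open>g\<close> at \<open>x\<^sub>k\<^sub>+\<^sub>1\<close> tested with a minimizer \<open>z\<close>, \<open>g\<close> at \<open>x\<^sub>k\<close>
  tested with \<open>x\<^sub>k\<^sub>+\<^sub>1\<close>, and \<open>f + g\<close> at \<open>x\<^sub>k\<close> tested with \<open>x\<^sub>k\<^sub>-\<^sub>1\<close>.  Young's inequality for
  \<open>\<rho>\<^sub>k\<^sub>+\<^sub>1 \<langle>H\<^sub>k, x\<^sub>k\<^sub>+\<^sub>1 - x\<^sub>k\<rangle>\<close> with \<open>H\<^sub>k = x\<^sub>k\<^sub>-\<^sub>1 - x\<^sub>k - \<gamma>\<^sub>k (\<nabla>f(x\<^sub>k\<^sub>-\<^sub>1) - \<nabla>f(x\<^sub>k))\<close> then gives the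
  descent of the merit function, and telescoping gives the rate.  For convergence, the stepsize rule
  bounds \<open>\<rho>\<^sub>k\<^sub>+\<^sub>1 \<parallel>H\<^sub>k\<parallel>\<close> by a multiple of \<open>\<parallel>x\<^sub>k - x\<^sub>k\<^sub>-\<^sub>1\<parallel>\<close>, hence \<open>\<gamma>\<^sub>k\<^sub>+\<^sub>1 P\<^sub>k\<close> by a multiple of
  \<open>\<parallel>x\<^sub>k - z\<parallel>\<close> even if the stepsizes are unbounded; so the merit function tends to \<open>0\<close> as soon as two
  consecutive iterates approach the same minimizer \<open>z\<close> along a subsequence.
\<close>

section \<open>Directional derivatives, subgradients and lower semicontinuity\<close>

lemma GDERIV_directional_limit:
  fixes h :: "'a::real_inner \<Rightarrow> real"
  assumes "GDERIV h z :> D"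
  shows "((\<lambda>t. (h (z + t *\<^sub>R d) - h z) / t) \<longlongrightarrow> inner D d) (at_right 0)"
proof -
  have "((\<lambda>t. h (z + t *\<^sub>R d)) has_derivative (\<lambda>s. inner (s *\<^sub>R d) D)) (at 0)"
    by (rule has_derivative_compose[where g = h and f = "\<lambda>t. z + t *\<^sub>R d"])
      (use assms in \<open>auto intro!: derivative_eq_intros simp: gderiv_def\<close>)
  then have "((\<lambda>t. h (z + t *\<^sub>R d)) has_real_derivative inner D d) (at 0)"
    by (simp add: has_field_derivative_def inner_commute mult.commute[of _ "inner _ _"])
  then have "((\<lambda>t. (h (z + t *\<^sub>R d) - h z) / t) \<longlongrightarrow> inner D d) (at 0)"
    by (simp add: has_field_derivative_iff)
  then show ?thesis
    by (rule tendsto_within_subset) auto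
qed

lemma convex_on_above_gradient:
  fixes f :: "'a::real_inner \<Rightarrow> real"
  assumes "convex_on UNIV f" "GDERIV f a :> D"
  shows "f a + inner D (b - a) \<le> f b"
proof -
  have "\<forall>\<^sub>F t in at_right 0. (f (a + t *\<^sub>R (b - a)) - f a) / t \<le> f b - f a"
    using eventually_at_right_real[OF zero_less_one]
  proof eventually_elim
    case (elim t)
    have "f (a + t *\<^sub>R (b - a)) \<le> (1 - t) * f a + t * f b"
      using convex_onD[OF assms(1), of t a b] elim by (simp add: algebra_simps)
    then show ?case using elim by (simp add: field_simps)
  qed
  then have "inner D (b - a) \<le> f b - f a"
    by (rule tendsto_upperbound[OF GDERIV_directional_limit[OF assms(2)]]) simp
  then show ?thesis by simp
qed

lemma argmin_iff: "z \<in> argmin h \<longleftrightarrow> (\<forall>w. h z \<le> h w)" for h :: "'a \<Rightarrow> ereal"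
  by (auto simp: argmin_def is_arg_min_def not_less)

lemma argmin_finite:
  assumes "proper g" "z \<in> argmin (\<lambda>w. ereal (h w) + g w)"
  shows "\<bar>g z\<bar> \<noteq> \<infinity>"
proof -
  obtain w where "g w \<noteq> \<infinity>" "g w \<noteq> -\<infinity>" "g z \<noteq> -\<infinity>"
    using assms by (auto simp: proper_def)
  moreover have "ereal (h z) + g z \<le> ereal (h w) + g w"
    using assms by (auto simp: argmin_iff)
  ultimately show ?thesis by (cases "g w"; cases "g z") auto
qed

text \<open>Fermat's rule for a smooth plus a convex function: \<open>-D\<close> is a subgradient of
  \<open>g\<close> at \<open>z\<close>. Compare \<open>z\<close> with the point
  \<open>z + t *\<^sub>R (w - z)\<close>, bound \<open>g\<close> there by convexity, divide by
  \<open>t\<close> and let \<open>t\<close> tend to 0 from the right.\<close>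

lemma argmin_sum_subgradient:
  fixes g :: "'a::real_inner \<Rightarrow> ereal"
  assumes "proper g" "econvex g" "GDERIV h z :> D"
    and z: "z \<in> argmin (\<lambda>w. ereal (h w) + g w)" and w: "\<bar>g w\<bar> \<noteq> \<infinity>"
  shows "real_of_ereal (g z) - inner D (w - z) \<le> real_of_ereal (g w)"
proof -
  obtain a where a: "g z = ereal a" using argmin_finite[OF assms(1) z] by auto
  obtain b where b: "g w = ereal b" using w by auto
  have "\<forall>\<^sub>F t in at_right 0. a - b \<le> (h (z + t *\<^sub>R (w - z)) - h z) / t"
    using eventually_at_right_real[OF zero_less_one]
  proof eventually_elim
    case (elim t)
    have eq: "(1 - t) *\<^sub>R z + t *\<^sub>R w = z + t *\<^sub>R (w - z)" by (simp add: algebra_simps)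
    have c: "g (z + t *\<^sub>R (w - z)) \<le> ereal ((1 - t) * a + t * b)"
      using assms(2)[unfolded econvex_def, rule_format, of t z w] elim unfolding eq by (simp add: a b)
    have m: "ereal (h z) + ereal a \<le> ereal (h (z + t *\<^sub>R (w - z))) + g (z + t *\<^sub>R (w - z))"
      using z by (simp add: argmin_iff a del: plus_ereal.simps)
    have "h z + a \<le> h (z + t *\<^sub>R (w - z)) + ((1 - t) * a + t * b)"
      using m c by (cases "g (z + t *\<^sub>R (w - z))") auto
    then show ?case using elim by (simp add: field_simps)
  qed
  then have "a - b \<le> inner D (w - z)"
    by (rule tendsto_lowerbound[OF GDERIV_directional_limit[OF assms(3)]]) simp
  then show ?thesis by (simp add: a b)
qed

lemma lsc_le_limit:
  fixes g :: "'a::topological_space \<Rightarrow> ereal"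
  assumes "lsc g" and X: "(X \<longlongrightarrow> z) A" "((\<lambda>n. g (X n)) \<longlongrightarrow> c) A" "A \<noteq> bot"
  shows "g z \<le> c"
proof (rule ccontr)
  assume "\<not> g z \<le> c"
  then obtain a where a: "c < a" "a < g z" using dense by (meson not_le)
  then have "a < Liminf (at z) g"
    using assms(1) by (auto simp: lsc_def intro: less_le_trans)
  then have "\<forall>\<^sub>F w in at z. a < g w" by (rule less_LiminfD)
  \<comment> \<open>\<open>at z\<close> leaves out the point \<open>z\<close> itself, which
    \<open>a < g z\<close> supplies.\<close>
  then have "\<forall>\<^sub>F w in nhds z. a < g w"
    unfolding eventually_at_filter by (rule eventually_mono) (use a in auto)
  then have "\<forall>\<^sub>F n in A. a \<le> g (X n)"
    using X(1) by (auto simp: filterlim_iff elim!: eventually_mono)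
  then have "a \<le> c" by (rule tendsto_lowerbound[OF X(2) _ X(3)])
  then show False using a by simp
qed

lemma GDERIV_prox_penalty:
  assumes "\<tau> \<noteq> 0"
  shows "GDERIV (\<lambda>w. 1 / (2 * \<tau>) * (norm (w - u))\<^sup>2) z :> (1 / \<tau>) *\<^sub>R (z - u)"
  unfolding gderiv_def power2_norm_eq_inner
  by (rule derivative_eq_intros refl)+
    (use assms in \<open>simp add: fun_eq_iff inner_commute scaleR_right_diff_distrib[symmetric]\<close>)

lemma antimono_int_tendsto:
  fixes U :: "int \<Rightarrow> real"
  assumes dec: "\<And>k. k \<ge> a \<Longrightarrow> U (k + 1) \<le> U k" and bd: "\<And>k. k \<ge> a \<Longrightarrow> b \<le> U k"
  shows "\<exists>l. (U \<longlongrightarrow> l) at_top"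
proof -
  have mono: "U k \<le> U j" if "a \<le> j" "j \<le> k" for j k
    using that(2)
  proof (induction rule: int_ge_induct)
    case (step i) with dec[of i] that show ?case by simp
  qed simp
  have bdd: "bdd_below (U ` {a..})" using bd by (auto intro!: bdd_belowI[of _ b])
  have "(U \<longlongrightarrow> (INF k\<in>{a..}. U k)) at_top"
  proof (rule decreasing_tendsto)
    show "\<forall>\<^sub>F k in at_top. (INF k\<in>{a..}. U k) \<le> U k"
      using bdd by (auto simp: eventually_at_top_linorder intro!: exI[of _ a] cINF_lower)
    fix y assume "(INF k\<in>{a..}. U k) < y"
    then obtain j where "j \<ge> a" "U j < y" using bdd by (auto simp: cINF_less_iff)
    then have "\<forall>k\<ge>j. U k < y" using mono by (meson le_less_trans)
    then show "\<forall>\<^sub>F k in at_top. U k < y" by (auto simp: eventually_at_top_linorder)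
  qed
  then show ?thesis ..
qed

section \<open>The stepsize rule over the reals\<close>

text \<open>The quantity under the root of the stepsize rule, before its positive part is taken;
  \<open>curv_eq\<close> gives it in terms of gradient differences.\<close>

abbreviation curv :: "('a::real_inner \<Rightarrow> 'a) \<Rightarrow> (int \<Rightarrow> 'a) \<Rightarrow> (int \<Rightarrow> real) \<Rightarrow> int \<Rightarrow> real" where
  "curv F x \<gamma> k \<equiv> \<gamma> k * ell F x k * (\<gamma> k * cc F x k - 1)"

lemma step_bound_eq:
  "step_bound F x \<gamma> k =
    ereal (\<gamma> k) * ereal (if curv F x \<gamma> k \<le> 0 then sqrt (1 + step_ratio \<gamma> k)
      else min (sqrt (1 + step_ratio \<gamma> k)) (1 / (2 * sqrt (curv F x \<gamma> k))))"
proof -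
  have "min (ereal a) (1 / ereal (2 * sqrt (max s 0))) = ereal (if s \<le> 0 then a else min a (1 / (2 * sqrt s)))"
    for a s :: real
  proof (cases "s \<le> 0")
    case True
    then have max: "max s 0 = 0" by simp
    have top: "1 / ereal (2 * sqrt 0) = \<infinity>" by (simp only: divide_ereal_def) simp
    show ?thesis unfolding max top using True by simp
  next
    case False
    then have "1 / ereal (2 * sqrt (max s 0)) = ereal (1 / (2 * sqrt s))"
      by (simp add: one_ereal_def del: ereal_eq_1)
    then show ?thesis using False by (simp add: min_def)
  qed
  then show ?thesis unfolding step_bound_def step_ratio_def by simp
qed

text \<open>Each term of the minimum gives one estimate; the second is trivial if
  \<open>curv\<close> is nonpositive. The rule enters the convergence analysis only through these
  upper bounds, which hold with "\<le>" as well.\<close>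

lemma le_step_boundD:
  assumes "0 < \<gamma> k" "0 < \<gamma> (k + 1)" "0 < \<gamma> (k - 1)" "ereal (\<gamma> (k + 1)) \<le> step_bound F x \<gamma> k"
  shows "(step_ratio \<gamma> (k + 1))\<^sup>2 \<le> 1 + step_ratio \<gamma> k"
    and "(step_ratio \<gamma> (k + 1))\<^sup>2 * curv F x \<gamma> k \<le> 1/4"
proof -
  let ?s = "curv F x \<gamma> k" and ?r = "step_ratio \<gamma> (k + 1)"
  have r0: "0 < ?r" "0 < step_ratio \<gamma> k" using assms by (auto simp: step_ratio_def)
  have le: "?r \<le> (if ?s \<le> 0 then sqrt (1 + step_ratio \<gamma> k)
      else min (sqrt (1 + step_ratio \<gamma> k)) (1 / (2 * sqrt ?s)))"
    using assms(4) assms(1) unfolding step_bound_eq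
    by (simp add: step_ratio_def[of \<gamma> "k + 1"] pos_divide_le_eq mult.commute)
  then have "?r \<le> sqrt (1 + step_ratio \<gamma> k)" by (auto split: if_splits)
  then show "?r\<^sup>2 \<le> 1 + step_ratio \<gamma> k"
    using r0 by (metis abs_of_nonneg add_nonneg_nonneg less_imp_le real_le_rsqrt real_sqrt_le_iff
        real_sqrt_pow2 sqrt_le_D zero_less_one power_mono)
  show "?r\<^sup>2 * ?s \<le> 1/4"
  proof (cases "?s \<le> 0")
    case True
    then show ?thesis by (smt (verit) mult_nonneg_nonpos zero_le_power2 divide_nonneg_nonneg)
  next
    case False
    then have "?r \<le> 1 / (2 * sqrt ?s)" using le by auto
    then have "?r * sqrt ?s \<le> 1 / 2" using False by (simp add: field_simps)
    then have "(?r * sqrt ?s)\<^sup>2 \<le> (1/2)\<^sup>2" using r0 False by (intro power_mono) auto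
    then show ?thesis using False by (simp add: power_mult_distrib power_divide)
  qed
qed

lemma norm_diff_scaleR_sq:
  "(norm (a - c *\<^sub>R b))\<^sup>2 = (norm a)\<^sup>2 - 2 * c * inner b a + c\<^sup>2 * (norm b)\<^sup>2" for a b :: "'a::real_inner"
  unfolding power2_norm_eq_inner
  by (simp add: inner_diff_left inner_diff_right inner_commute power2_eq_square algebra_simps)

section \<open>Setting and optimality conditions\<close>

text \<open>Positive stepsizes and the rule as an inequality cover both the exact and the relaxed
  method; lemmas on lower bounds for the stepsizes assume equality separately.\<close>

locale adaptive_prox_grad =
  fixes f :: "'a::euclidean_space \<Rightarrow> real" and F :: "'a \<Rightarrow> 'a" and g :: "'a \<Rightarrow> ereal"
    and x :: "int \<Rightarrow> 'a" and \<gamma> :: "int \<Rightarrow> real"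
  assumes cvx: "convex_on UNIV f" and grad: "\<And>w. GDERIV f w :> F w"
    and lip: "locally_Lipschitz F"
    and g: "proper g" "lsc g" "econvex g"
    and ne: "argmin (\<lambda>w. ereal (f w) + g w) \<noteq> {}"
    and iter: "prox_grad_iterates F g x \<gamma>"
    and \<gamma>_pos: "\<And>k. -1 \<le> k \<Longrightarrow> 0 < \<gamma> k"
    and \<gamma>_le: "\<And>k. 0 \<le> k \<Longrightarrow> ereal (\<gamma> (k + 1)) \<le> step_bound F x \<gamma> k"
begin

abbreviation "\<phi> \<equiv> \<lambda>w. ereal (f w) + g w"
abbreviation "\<rho> \<equiv> step_ratio \<gamma>"
abbreviation "d k \<equiv> norm (x k - x (k - 1))"

text \<open>Real counterparts of \<open>g\<close>, of the minimum, of \<open>cost_gap\<close> and of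
  \<open>merit\<close>. Since \<open>g (x (-1))\<close> may be infinite, \<open>P\<close> is tied to
  the cost from index 0 on and \<open>U\<close> to the merit from index 1 on.\<close>

definition gr :: "'a \<Rightarrow> real" where "gr w = real_of_ereal (g w)"
definition m :: real where "m = real_of_ereal (INF w. \<phi> w)"
definition P :: "int \<Rightarrow> real" where "P k = f (x k) + gr (x k) - m"
definition U :: "'a \<Rightarrow> int \<Rightarrow> real" where
  "U z k = 1/2 * (norm (x k - z))\<^sup>2 + 1/4 * (d k)\<^sup>2 + \<gamma> k * (1 + \<rho> k) * P (k - 1)"

lemma INF_eq: "z \<in> argmin \<phi> \<Longrightarrow> (INF w. \<phi> w) = \<phi> z"
  by (rule antisym[OF INF_lower INF_greatest]) (auto simp: argmin_iff)

lemma g_argmin: "z \<in> argmin \<phi> \<Longrightarrow> g z = ereal (gr z)"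
  using argmin_finite[OF g(1)] by (simp add: gr_def ereal_real)

lemma INF_m: "(INF w. \<phi> w) = ereal m"
proof -
  obtain z where z: "z \<in> argmin \<phi>" using ne by auto
  then show ?thesis by (simp add: m_def INF_eq[OF z] g_argmin)
qed

lemma m_eq: "z \<in> argmin \<phi> \<Longrightarrow> m = f z + gr z"
  using INF_m INF_eq by (simp add: g_argmin)

lemma iter_argmin:
  assumes "0 \<le> k"
  shows "x k \<in> argmin (\<lambda>w. ereal (1 / (2 * \<gamma> k) * (norm (w - (x (k - 1) - \<gamma> k *\<^sub>R F (x (k - 1)))))\<^sup>2) + g w)"
  using iter[unfolded prox_grad_iterates_def, rule_format, of "k - 1"] assms
  by (simp add: prox_def add.commute)

lemma g_iter: "0 \<le> k \<Longrightarrow> g (x k) = ereal (gr (x k))"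
  using argmin_finite[OF g(1) iter_argmin[of k]] by (simp add: gr_def ereal_real)

text \<open>Optimality of the proximal step, multiplied by \<open>\<gamma> k\<close> to clear the
  denominator.\<close>

lemma iter_subgradient:
  assumes k: "0 \<le> k" and w: "\<bar>g w\<bar> \<noteq> \<infinity>"
  shows "\<gamma> k * gr (x k) + inner (x (k - 1) - x k - \<gamma> k *\<^sub>R F (x (k - 1))) (w - x k) \<le> \<gamma> k * gr w"
proof -
  have p: "0 < \<gamma> k" using \<gamma>_pos[of k] k by simp
  from p have "\<gamma> k \<noteq> 0" by simp
  from argmin_sum_subgradient[OF g(1,3) GDERIV_prox_penalty[OF this] iter_argmin[OF k] w]
  have "gr (x k) - 1 / \<gamma> k * inner (x k - (x (k - 1) - \<gamma> k *\<^sub>R F (x (k - 1)))) (w - x k) \<le> gr w"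
    by (simp add: gr_def)
  then have "\<gamma> k * (gr (x k) - 1 / \<gamma> k * inner (x k - (x (k - 1) - \<gamma> k *\<^sub>R F (x (k - 1)))) (w - x k)) \<le> \<gamma> k * gr w"
    using p by (intro mult_left_mono) auto
  then show ?thesis using p by (simp add: right_diff_distrib inner_diff_left algebra_simps)
qed

lemma argmin_subgradient:
  assumes "z \<in> argmin \<phi>" and w: "\<bar>g w\<bar> \<noteq> \<infinity>"
  shows "gr z - inner (F z) (w - z) \<le> gr w"
  using argmin_sum_subgradient[OF g(1,3) grad assms] by (simp add: gr_def)

lemma f_above: "f a + inner (F a) (b - a) \<le> f b"
  by (rule convex_on_above_gradient[OF cvx grad])

lemma P_nonneg: "0 \<le> k \<Longrightarrow> 0 \<le> P k"
  using INF_lower[of "x k" UNIV \<phi>] by (simp add: INF_m g_iter P_def)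

lemma \<rho>_pos: "0 \<le> k \<Longrightarrow> 0 < \<rho> k"
  using \<gamma>_pos[of k] \<gamma>_pos[of "k - 1"] by (simp add: step_ratio_def)

lemma \<rho>_bounds:
  assumes "0 \<le> k"
  shows "(\<rho> (k + 1))\<^sup>2 \<le> 1 + \<rho> k" "(\<rho> (k + 1))\<^sup>2 * curv F x \<gamma> k \<le> 1/4"
  using le_step_boundD[OF _ _ _ \<gamma>_le[OF assms]] \<gamma>_pos assms by auto

lemma \<gamma>_Suc: "0 \<le> k \<Longrightarrow> \<gamma> (k + 1) = \<rho> (k + 1) * \<gamma> k"
  using \<gamma>_pos[of k] by (simp add: step_ratio_def)

section \<open>Gradient differences along the iterates\<close>

abbreviation "dF k \<equiv> F (x (k - 1)) - F (x k)"
abbreviation "dx k \<equiv> x (k - 1) - x k"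
abbreviation "Is k \<equiv> inner (dF k) (dx k)"
text \<open>Difference of the values of the forward step \<open>w - \<gamma> k *\<^sub>R F w\<close>
  at \<open>x (k - 1)\<close> and at \<open>x k\<close>.\<close>

abbreviation "H k \<equiv> dx k - \<gamma> k *\<^sub>R dF k"

lemma F_monotone: "0 \<le> inner (F a - F b) (a - b)"
  using f_above[of a b] f_above[of b a] by (simp add: inner_diff_left inner_diff_right)

text \<open>
  Through this identity the Lipschitz modulus enters only via \<open>\<parallel>\<nabla>f(x\<^sub>k\<^sub>-\<^sub>1) - \<nabla>f(x\<^sub>k)\<parallel>\<close>, so that
  cocoercivity (which may fail with the modulus of a bounded set) is not needed.
\<close>

lemma curv_eq: "curv F x \<gamma> k * (norm (dx k))\<^sup>2 = (\<gamma> k)\<^sup>2 * (norm (dF k))\<^sup>2 - \<gamma> k * Is k"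
proof (cases "Is k = 0")
  case True
  \<comment> \<open>A zero denominator in \<open>cc\<close> forces equal gradients, so
    \<open>ell\<close> is 0 and both sides vanish.\<close>
  then have "F (x (k - 1)) = F (x k)"
    by (rule gradient_eq_if_inner_eq_0[OF cvx grad])
  then show ?thesis by (simp add: ell_def)
next
  case False
  then have "dx k \<noteq> 0" by auto
  then show ?thesis using False by (simp add: ell_def cc_def power2_eq_square field_simps)
qed

lemma norm_H: "(norm (H k))\<^sup>2 = (norm (dx k))\<^sup>2 - 2 * \<gamma> k * Is k + (\<gamma> k)\<^sup>2 * (norm (dF k))\<^sup>2"
  using norm_diff_scaleR_sq[of "dx k" "\<gamma> k" "dF k"] by simp

text \<open>Adding the gradient inequality of \<open>f\<close> at \<open>x k\<close> to the
  optimality condition shows that \<open>H k\<close> is \<open>\<gamma> k\<close> times a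
  subgradient of the cost at \<open>x k\<close>.\<close>

lemma cost_subgradient:
  assumes k: "0 \<le> k" and w: "\<bar>g w\<bar> \<noteq> \<infinity>"
  shows "\<gamma> k * (f (x k) + gr (x k)) + inner (H k) (w - x k) \<le> \<gamma> k * (f w + gr w)"
proof -
  have "\<gamma> k * (f (x k) + inner (F (x k)) (w - x k)) \<le> \<gamma> k * f w"
    using f_above \<gamma>_pos[of k] k by (intro mult_left_mono) auto
  then show ?thesis using iter_subgradient[OF assms]
    by (simp add: inner_diff_left algebra_simps)
qed

section \<open>Descent of the merit function\<close>

text \<open>In the sum of facts 1, 2 and 3 the values \<open>gr (x (k + 1))\<close> and the inner
  products with \<open>F (x k)\<close> cancel.\<close>

lemma prox_step:
  assumes z: "z \<in> argmin \<phi>" and k: "0 \<le> k"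
  shows "1/2 * (norm (x (k + 1) - z))\<^sup>2 + 1/2 * (d (k + 1))\<^sup>2 + \<gamma> (k + 1) * P k
      + \<rho> (k + 1) * inner (H k) (x (k + 1) - x k) \<le> 1/2 * (norm (x k - z))\<^sup>2"
proof -
  have gk: "0 < \<gamma> k" "0 < \<gamma> (k + 1)" using \<gamma>_pos k by auto
  have g0: "\<bar>g z\<bar> \<noteq> \<infinity>" "\<bar>g (x (k + 1))\<bar> \<noteq> \<infinity>" using z k by (auto simp: g_argmin g_iter)
  have 1: "\<gamma> (k + 1) * gr (x (k + 1)) + inner (x k - x (k + 1) - \<gamma> (k + 1) *\<^sub>R F (x k)) (z - x (k + 1)) \<le> \<gamma> (k + 1) * gr z"
    using iter_subgradient[OF _ g0(1), of "k + 1"] k by simp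
  have 2: "\<gamma> (k + 1) * (f (x k) + inner (F (x k)) (z - x k)) \<le> \<gamma> (k + 1) * f z"
    using f_above gk by (intro mult_left_mono) auto
  have sub: "x (k - 1) - x k - \<gamma> k *\<^sub>R F (x (k - 1)) = H k - \<gamma> k *\<^sub>R F (x k)"
    by (simp add: scaleR_right_diff_distrib)
  \<comment> \<open>The factor \<open>\<rho> (k + 1)\<close> turns the weight
    \<open>\<gamma> k\<close> into \<open>\<gamma> (k + 1)\<close>, matching fact 1.\<close>
  have "\<rho> (k + 1) * (\<gamma> k * gr (x k) + inner (x (k - 1) - x k - \<gamma> k *\<^sub>R F (x (k - 1))) (x (k + 1) - x k)) \<le> \<rho> (k + 1) * (\<gamma> k * gr (x (k + 1)))"
    using iter_subgradient[OF k g0(2)] \<rho>_pos[of "k + 1"] k by (intro mult_left_mono) auto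
  then have 3: "\<gamma> (k + 1) * gr (x k) + \<rho> (k + 1) * inner (H k) (x (k + 1) - x k) - \<gamma> (k + 1) * inner (F (x k)) (x (k + 1) - x k) \<le> \<gamma> (k + 1) * gr (x (k + 1))"
    unfolding sub inner_diff_left[of "H k"] \<gamma>_Suc[OF k] by (simp add: algebra_simps)
  have 4: "inner (x k - x (k + 1)) (z - x (k + 1)) = 1/2 * (d (k + 1))\<^sup>2 + 1/2 * (norm (x (k + 1) - z))\<^sup>2 - 1/2 * (norm (x k - z))\<^sup>2"
    unfolding power2_norm_eq_inner by (simp add: inner_diff_left inner_diff_right inner_commute field_simps)
  have 5: "inner (x k - x (k + 1) - \<gamma> (k + 1) *\<^sub>R F (x k)) (z - x (k + 1)) =
     inner (x k - x (k + 1)) (z - x (k + 1)) - \<gamma> (k + 1) * inner (F (x k)) (z - x k) + \<gamma> (k + 1) * inner (F (x k)) (x (k + 1) - x k)"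
    by (simp add: inner_diff_left inner_diff_right algebra_simps)
  have 6: "\<gamma> (k + 1) * P k = \<gamma> (k + 1) * f (x k) + \<gamma> (k + 1) * gr (x k) - \<gamma> (k + 1) * f z - \<gamma> (k + 1) * gr z"
    by (simp add: P_def m_eq[OF z] algebra_simps)
  show ?thesis using 1 2 3 4 unfolding 5 6 by (simp add: distrib_left)
qed

text \<open>Stated without \<open>U z k\<close> on the right:
  \<open>converges_if_consecutive\<close> needs a bound whose terms all vanish when
  \<open>x k\<close> and \<open>x (k - 1)\<close> approach \<open>z\<close>.\<close>

lemma main_descent:
  assumes z: "z \<in> argmin \<phi>" and k: "1 \<le> k"
  shows "U z (k + 1) \<le> 1/2 * (norm (x k - z))\<^sup>2 + (\<rho> (k + 1))\<^sup>2 * \<gamma> k * P (k - 1)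
     + (\<rho> (k + 1))\<^sup>2 * curv F x \<gamma> k * (d k)\<^sup>2"
proof -
  let ?r = "\<rho> (k + 1)"
  have d: "norm (dx k) = d k" by (rule norm_minus_commute)
  \<comment> \<open>Young's inequality, weighted so that of the
    \<open>1/2 * (d (k + 1))\<^sup>2\<close> in \<open>prox_step\<close> the quarter occurring in
    \<open>U z (k + 1)\<close> is left.\<close>
  have "0 \<le> (norm ((1/2) *\<^sub>R (x (k + 1) - x k) - (- ?r) *\<^sub>R H k))\<^sup>2" by simp
  also have "\<dots> = 1/4 * (d (k + 1))\<^sup>2 + ?r * inner (H k) (x (k + 1) - x k) + ?r\<^sup>2 * (norm (H k))\<^sup>2"
    unfolding norm_diff_scaleR_sq by (simp add: power_mult_distrib power2_eq_square)
  finally have 1: "- (?r * inner (H k) (x (k + 1) - x k)) \<le> 1/4 * (d (k + 1))\<^sup>2 + ?r\<^sup>2 * (norm (H k))\<^sup>2"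
    by simp
  \<comment> \<open>The bracket is \<open>inner (H k) (dx k)\<close>, which
    \<open>cost_subgradient\<close> tested with \<open>x (k - 1)\<close> bounds by a cost
    difference.\<close>
  have nH: "(norm (H k))\<^sup>2 = ((d k)\<^sup>2 - \<gamma> k * Is k) + curv F x \<gamma> k * (d k)\<^sup>2"
    using curv_eq[of k] unfolding norm_H d by simp
  have "inner (H k) (dx k) = (d k)\<^sup>2 - \<gamma> k * Is k"
    unfolding d[symmetric] power2_norm_eq_inner inner_diff_left[of "dx k" "\<gamma> k *\<^sub>R dF k"] by simp
  then have "(d k)\<^sup>2 - \<gamma> k * Is k \<le> \<gamma> k * (P (k - 1) - P k)"
    using cost_subgradient[of k "x (k - 1)"] k by (simp add: g_iter P_def algebra_simps)
  then have 2: "?r\<^sup>2 * ((d k)\<^sup>2 - \<gamma> k * Is k) \<le> ?r\<^sup>2 * (\<gamma> k * (P (k - 1) - P k))"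
    by (intro mult_left_mono) auto
  \<comment> \<open>The term with \<open>P k\<close> released by fact 2 completes the cost term of
    \<open>U z (k + 1)\<close>.\<close>
  have 3: "\<gamma> (k + 1) * (1 + ?r) * P k = \<gamma> (k + 1) * P k + ?r\<^sup>2 * (\<gamma> k * P k)"
    using \<gamma>_Suc[of k] k by (simp add: power2_eq_square algebra_simps)
  have "?r\<^sup>2 * (norm (H k))\<^sup>2 \<le> ?r\<^sup>2 * (\<gamma> k * (P (k - 1) - P k)) + ?r\<^sup>2 * curv F x \<gamma> k * (d k)\<^sup>2"
    using 2 unfolding nH by (simp add: algebra_simps)
  then show ?thesis
    using 1 3 prox_step[OF z, of k] k unfolding U_def
    by (simp add: right_diff_distrib mult.assoc)
qed

lemma descent:
  assumes "z \<in> argmin \<phi>" "1 \<le> k"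
  shows "U z (k + 1) \<le> U z k - (1/4 - (\<rho> (k + 1))\<^sup>2 * curv F x \<gamma> k) * (d k)\<^sup>2
    - \<gamma> k * (1 + \<rho> k - (\<rho> (k + 1))\<^sup>2) * P (k - 1)"
proof -
  have "\<gamma> k * (1 + \<rho> k - (\<rho> (k + 1))\<^sup>2) * P (k - 1)
      = \<gamma> k * (1 + \<rho> k) * P (k - 1) - (\<rho> (k + 1))\<^sup>2 * \<gamma> k * P (k - 1)"
    by (simp only: right_diff_distrib left_diff_distrib mult.commute)
  then show ?thesis using main_descent[OF assms]
    unfolding U_def[of z k] left_diff_distrib[of "1/4"] by linarith
qed

lemma U_antimono:
  assumes "z \<in> argmin \<phi>" "1 \<le> k"
  shows "U z (k + 1) \<le> U z k"
proof -
  have "0 \<le> (1/4 - (\<rho> (k + 1))\<^sup>2 * curv F x \<gamma> k) * (d k)\<^sup>2"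
    using \<rho>_bounds(2)[of k] assms by (intro mult_nonneg_nonneg) auto
  moreover have "0 \<le> \<gamma> k * (1 + \<rho> k - (\<rho> (k + 1))\<^sup>2) * P (k - 1)"
    using \<rho>_bounds(1)[of k] \<gamma>_pos[of k] P_nonneg[of "k - 1"] assms by (intro mult_nonneg_nonneg) auto
  ultimately show ?thesis using descent[OF assms] by linarith
qed

lemma last_term_nonneg: "1 \<le> k \<Longrightarrow> 0 \<le> \<gamma> k * (1 + \<rho> k) * P (k - 1)"
  using \<gamma>_pos[of k] \<rho>_pos[of k] P_nonneg[of "k - 1"] by (intro mult_nonneg_nonneg) auto

lemma U_ge_norm: "1 \<le> k \<Longrightarrow> 1/2 * (norm (x k - z))\<^sup>2 \<le> U z k"
  unfolding U_def using last_term_nonneg[of k] zero_le_power2[of "d k"] by linarith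

lemma U_ge_cost: "\<gamma> k * (1 + \<rho> k) * P (k - 1) \<le> U z k"
  by (simp add: U_def)

lemma U_nonneg: "1 \<le> k \<Longrightarrow> 0 \<le> U z k"
  by (rule order_trans[OF _ U_ge_norm]) auto

lemma U_le_U1:
  assumes "z \<in> argmin \<phi>" "1 \<le> k"
  shows "U z k \<le> U z 1"
  using assms(2)
proof (induction rule: int_ge_induct)
  case (step i) then show ?case using U_antimono[OF assms(1), of i] by simp
qed simp

section \<open>Boundedness and the best-cost rate\<close>

lemma bounded_iterates: "bounded (x ` {-1..})"
proof -
  obtain z where z: "z \<in> argmin \<phi>" using ne by auto
  have "dist z (x k) \<le> sqrt (2 * U z 1)" if "1 \<le> k" for k
    using U_ge_norm[OF that, of z] U_le_U1[OF z that]
    by (simp add: dist_norm norm_minus_commute real_le_rsqrt)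
  then have "bounded (x ` {1..})"
    by (auto simp: bounded_def)
  moreover have "{-1..} = {-1, 0} \<union> {1::int..}" by auto
  ultimately show ?thesis by (simp add: image_Un)
qed

text \<open>Telescopes \<open>descent\<close> with \<open>P j\<close> replaced by the lower bound
  \<open>c\<close>. Start \<open>N = 0\<close> serves the rate; arbitrary \<open>N\<close> yields
  late indices of small cost in \<open>convergence\<close>.\<close>

lemma rate:
  assumes z: "z \<in> argmin \<phi>" and "0 \<le> N" "N \<le> K" "0 \<le> c"
    and c: "\<And>j. N \<le> j \<Longrightarrow> j \<le> K \<Longrightarrow> c \<le> P j"
  shows "c * (\<Sum>k = N + 1..K + 1. \<gamma> k) \<le> U z (N + 1)"
proof -
  have ins: "(\<Sum>k = N + 1..J + 1. \<gamma> k) = \<gamma> (J + 1) + (\<Sum>k = N + 1..J. \<gamma> k)" if "N \<le> J" for J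
  proof -
    have "{N + 1..J + 1} = insert (J + 1) {N + 1..J}" using that by auto
    then show ?thesis by simp
  qed
  \<comment> \<open>The subtracted product is what remains of the telescoping sum after step
    \<open>J\<close>.\<close>
  have inv: "J \<le> K \<longrightarrow> U z (J + 1) - c * (\<gamma> (J + 1) * \<rho> (J + 1)) + c * (\<Sum>k = N + 1..J. \<gamma> k) \<le> U z (N + 1)"
    if "N \<le> J" for J
    using that
  proof (induction rule: int_ge_induct)
    case base
    show ?case using \<open>0 \<le> N\<close> \<open>0 \<le> c\<close> \<gamma>_pos[of "N + 1"] \<rho>_pos[of "N + 1"] by simp
  next
    case (step J)
    show ?case
    proof
      assume J: "J + 1 \<le> K"
      have J0: "0 \<le> J" using step \<open>0 \<le> N\<close> by simp
      let ?a = "\<gamma> (J + 1) * (1 + \<rho> (J + 1) - (\<rho> (J + 1 + 1))\<^sup>2)"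
      have a0: "0 \<le> ?a"
        using \<gamma>_pos[of "J + 1"] \<rho>_bounds(1)[of "J + 1"] J0 by simp
      have "c * ?a \<le> P J * ?a"
        using c[of J] step J by (intro mult_right_mono a0) auto
      moreover have "U z (J + 1 + 1) \<le> U z (J + 1) - P J * ?a"
      proof -
        have "0 \<le> (1/4 - (\<rho> (J + 1 + 1))\<^sup>2 * curv F x \<gamma> (J + 1)) * (d (J + 1))\<^sup>2"
          using \<rho>_bounds(2)[of "J + 1"] J0 by (intro mult_nonneg_nonneg) auto
        then show ?thesis using descent[OF z, of "J + 1"] J0 by (simp add: mult.commute)
      qed
      \<comment> \<open>The coefficient telescopes since \<open>\<gamma> (J + 1)\<close> times
        \<open>\<rho> (J + 1 + 1)\<close> is \<open>\<gamma> (J + 1 + 1)\<close>.\<close>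
      moreover have "?a = \<gamma> (J + 1) + \<gamma> (J + 1) * \<rho> (J + 1) - \<gamma> (J + 1 + 1) * \<rho> (J + 1 + 1)"
        using \<gamma>_Suc[of "J + 1"] J0 by (simp add: power2_eq_square algebra_simps)
      ultimately show "U z (J + 1 + 1) - c * (\<gamma> (J + 1 + 1) * \<rho> (J + 1 + 1)) + c * (\<Sum>k = N + 1..J + 1. \<gamma> k) \<le> U z (N + 1)"
        using step J unfolding ins[OF step.hyps] by (simp add: algebra_simps)
    qed
  qed
  \<comment> \<open>The cost term inside \<open>U z (K + 1)\<close> absorbs the subtracted product
    and adds the last summand \<open>\<gamma> (K + 1)\<close>.\<close>
  have "\<gamma> (K + 1) * (1 + \<rho> (K + 1)) * c \<le> \<gamma> (K + 1) * (1 + \<rho> (K + 1)) * P K"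
    using c[of K] assms \<gamma>_pos[of "K + 1"] \<rho>_pos[of "K + 1"] by (intro mult_left_mono) auto
  then have "\<gamma> (K + 1) * (1 + \<rho> (K + 1)) * c \<le> U z (K + 1)"
    using U_ge_cost[of "K + 1" z] assms by simp
  then show ?thesis using inv[of K] assms unfolding ins[OF \<open>N \<le> K\<close>] by (simp add: algebra_simps)
qed

section \<open>Cluster points and convergence\<close>

text \<open>Continuity of \<open>f\<close> forces \<open>g (x (r n))\<close> to tend to
  \<open>m - f z\<close>; lower semicontinuity then gives a cost of at most \<open>m\<close> at
  \<open>z\<close>.\<close>

lemma optimal_cluster_point:
  assumes r: "filterlim r at_top sequentially" and P0: "(\<lambda>n. P (r n)) \<longlonglongrightarrow> 0"
    and lim: "(\<lambda>n. x (r n)) \<longlonglongrightarrow> z"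
  shows "z \<in> argmin \<phi>"
proof -
  have "isCont f z" using grad[of z] by (auto simp: gderiv_def intro: has_derivative_continuous)
  then have "(\<lambda>n. f (x (r n))) \<longlonglongrightarrow> f z" using lim by (rule isCont_tendsto_compose)
  then have "(\<lambda>n. ereal (P (r n) + m - f (x (r n)))) \<longlonglongrightarrow> ereal (0 + m - f z)"
    by (intro tendsto_intros P0)
  moreover have "\<forall>\<^sub>F n in sequentially. ereal (P (r n) + m - f (x (r n))) = g (x (r n))"
    using r[unfolded filterlim_at_top, rule_format, of 0]
    by eventually_elim (simp add: g_iter P_def)
  ultimately have "(\<lambda>n. g (x (r n))) \<longlonglongrightarrow> ereal (0 + m - f z)"
    by (rule Lim_transform_eventually)
  from lsc_le_limit[OF g(2) lim this] have "g z \<le> ereal (m - f z)" by simp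
  then have "\<phi> z \<le> (INF w. \<phi> w)" unfolding INF_m by (cases "g z") auto
  then show ?thesis unfolding argmin_iff by (auto intro: order_trans INF_lower)
qed

lemma U_tendsto: "z \<in> argmin \<phi> \<Longrightarrow> \<exists>l. (U z \<longlongrightarrow> l) at_top"
  by (rule antimono_int_tendsto[of 1 _ 0]) (auto intro: U_antimono U_nonneg)

text \<open>Opial's argument: in \<open>U z k - U z' k\<close> only the distances remain, and the
  limits of this difference along the two subsequences have opposite signs.\<close>

lemma optimal_cluster_point_unique:
  assumes z: "z \<in> argmin \<phi>" "z' \<in> argmin \<phi>"
    and r: "filterlim r at_top sequentially" "(\<lambda>n. x (r n)) \<longlonglongrightarrow> z"
    and r': "filterlim r' at_top sequentially" "(\<lambda>n. x (r' n)) \<longlonglongrightarrow> z'"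
  shows "z = z'"
proof -
  obtain l l' where "(U z \<longlongrightarrow> l) at_top" "(U z' \<longlongrightarrow> l') at_top"
    using U_tendsto z by blast
  then have "((\<lambda>k. U z k - U z' k) \<longlongrightarrow> l - l') at_top" by (rule tendsto_diff)
  then have h: "((\<lambda>k. 1/2 * (norm (x k - z))\<^sup>2 - 1/2 * (norm (x k - z'))\<^sup>2) \<longlongrightarrow> l - l') at_top"
    by (simp add: U_def)
  have "(\<lambda>n. 1/2 * (norm (x (r n) - z))\<^sup>2 - 1/2 * (norm (x (r n) - z'))\<^sup>2)
      \<longlonglongrightarrow> 1/2 * (norm (z - z))\<^sup>2 - 1/2 * (norm (z - z'))\<^sup>2"
    by (intro tendsto_intros r)
  then have 1: "l - l' = 1/2 * (norm (z - z))\<^sup>2 - 1/2 * (norm (z - z'))\<^sup>2"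
    by (rule LIMSEQ_unique[OF filterlim_compose[OF h r(1)]])
  have "(\<lambda>n. 1/2 * (norm (x (r' n) - z))\<^sup>2 - 1/2 * (norm (x (r' n) - z'))\<^sup>2)
      \<longlonglongrightarrow> 1/2 * (norm (z' - z))\<^sup>2 - 1/2 * (norm (z' - z'))\<^sup>2"
    by (intro tendsto_intros r')
  then have 2: "l - l' = 1/2 * (norm (z' - z))\<^sup>2 - 1/2 * (norm (z' - z'))\<^sup>2"
    by (rule LIMSEQ_unique[OF filterlim_compose[OF h r'(1)]])
  from 1 2 have "- (1/2 * (norm (z' - z))\<^sup>2) = 1/2 * (norm (z' - z))\<^sup>2"
    by (simp add: norm_minus_commute)
  then show ?thesis by simp
qed

text \<open>With \<open>R\<close> the claimed bound, \<open>1 + R \<le> 2 * R \<le> R * R\<close>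
  because \<open>R\<close> is at least 2, so the recursion for the squared ratio preserves
  it.\<close>

lemma \<rho>_le:
  assumes "0 \<le> k"
  shows "\<rho> k \<le> max 2 (\<rho> 0)"
  using assms
proof (induction rule: int_ge_induct)
  case (step k)
  let ?R = "max 2 (\<rho> 0)"
  have "2 * ?R \<le> ?R * ?R" by (intro mult_right_mono) auto
  then have "(\<rho> (k + 1))\<^sup>2 \<le> ?R\<^sup>2"
    using \<rho>_bounds(1)[of k] step unfolding power2_eq_square by linarith
  then show ?case by (rule power2_le_imp_le) simp
qed simp

text \<open>Test \<open>cost_subgradient\<close> with \<open>z\<close> and apply Cauchy-Schwarz; the
  stepsize rule controls \<open>\<rho> (k + 1) * norm (H k)\<close>, so no bound on the stepsizes
  enters.\<close>

lemma cost_le: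
  assumes z: "z \<in> argmin \<phi>" and k: "0 \<le> k" and R: "\<rho> (k + 1) \<le> R"
  shows "\<gamma> (k + 1) * P k \<le> (R + 1) * d k * norm (x k - z)"
proof -
  let ?r = "\<rho> (k + 1)"
  have r0: "0 < ?r" using \<rho>_pos[of "k + 1"] k by simp
  have d: "norm (dx k) = d k" by (rule norm_minus_commute)
  have nH: "(norm (H k))\<^sup>2 = ((d k)\<^sup>2 - \<gamma> k * Is k) + curv F x \<gamma> k * (d k)\<^sup>2"
    using curv_eq[of k] unfolding norm_H d by simp
  have "0 \<le> \<gamma> k * Is k" using F_monotone \<gamma>_pos[of k] k by simp
  then have "?r\<^sup>2 * (norm (H k))\<^sup>2 \<le> ?r\<^sup>2 * ((d k)\<^sup>2 + curv F x \<gamma> k * (d k)\<^sup>2)"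
    unfolding nH by (intro mult_left_mono) auto
  also have "\<dots> = (?r\<^sup>2 + ?r\<^sup>2 * curv F x \<gamma> k) * (d k)\<^sup>2" by (simp add: algebra_simps)
  \<comment> \<open>The left factor is at most \<open>R\<^sup>2 + 1/4\<close>.\<close>
  also have "\<dots> \<le> (R + 1)\<^sup>2 * (d k)\<^sup>2"
  proof (rule mult_right_mono)
    have "?r\<^sup>2 \<le> R\<^sup>2" using R r0 by (intro power_mono) auto
    moreover have "(R + 1)\<^sup>2 = R\<^sup>2 + 2 * R + 1" by (simp add: power2_eq_square algebra_simps)
    ultimately show "?r\<^sup>2 + ?r\<^sup>2 * curv F x \<gamma> k \<le> (R + 1)\<^sup>2"
      using \<rho>_bounds(2)[OF k] R r0 by linarith
  qed simp
  finally have "(?r * norm (H k))\<^sup>2 \<le> ((R + 1) * d k)\<^sup>2" by (simp only: power_mult_distrib)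
  then have H: "?r * norm (H k) \<le> (R + 1) * d k"
    by (rule power2_le_imp_le) (use R r0 in simp)
  have "\<gamma> k * P k \<le> - inner (H k) (z - x k)"
    using cost_subgradient[OF k, of z] z by (simp add: g_argmin P_def m_eq[OF z] algebra_simps)
  also have "\<dots> \<le> norm (H k) * norm (x k - z)"
    using norm_cauchy_schwarz[of "H k" "x k - z"] by (metis inner_minus_right minus_diff_eq)
  finally have "?r * (\<gamma> k * P k) \<le> ?r * (norm (H k) * norm (x k - z))"
    using r0 by (intro mult_left_mono) auto
  also have "\<dots> \<le> (R + 1) * d k * norm (x k - z)"
    using mult_right_mono[OF H norm_ge_zero] by (simp add: mult.assoc)
  finally show ?thesis using \<gamma>_Suc[OF k] by (simp add: mult.assoc)
qed

text \<open>\<open>U z\<close> has a limit, and along \<open>r n + 1\<close> it is dominated by a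
  null sequence; hence it tends to 0 and takes the distance to \<open>z\<close> with it.\<close>

lemma converges_if_consecutive:
  assumes z: "z \<in> argmin \<phi>" and r: "filterlim r at_top sequentially"
    and l0: "(\<lambda>n. x (r n)) \<longlonglongrightarrow> z" and l1: "(\<lambda>n. x (r n - 1)) \<longlonglongrightarrow> z"
  shows "(x \<longlongrightarrow> z) at_top"
proof -
  define R where "R = max 2 (\<rho> 0)"
  obtain B where B: "\<And>k. -1 \<le> k \<Longrightarrow> norm (x k) \<le> B"
    using bounded_iterates by (auto simp: bounded_iff)
  \<comment> \<open>The bound of \<open>main_descent\<close> at \<open>r n\<close>, with ratios
    replaced by \<open>R\<close>, the \<open>curv\<close> term by a quarter, and the cost estimated
    by \<open>cost_le\<close>, where \<open>d (r n - 1)\<close> is at most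
    \<open>2 * B\<close>.\<close>
  define W where "W n = 1/2 * (norm (x (r n) - z))\<^sup>2
    + R\<^sup>2 * ((R + 1) * (2 * B) * norm (x (r n - 1) - z)) + 1/4 * (norm (x (r n) - x (r n - 1)))\<^sup>2" for n
  obtain l where l: "(U z \<longlongrightarrow> l) at_top" using U_tendsto[OF z] by blast
  have "W \<longlonglongrightarrow> 1/2 * (norm (z - z))\<^sup>2 + R\<^sup>2 * ((R + 1) * (2 * B) * norm (z - z)) + 1/4 * (norm (z - z))\<^sup>2"
    unfolding W_def by (intro tendsto_intros l0 l1)
  then have W: "W \<longlonglongrightarrow> 0" by simp
  have "U z (r n + 1) \<le> W n" if k: "1 \<le> r n" for n
  proof -
    let ?k = "r n"
    have \<rho>R: "\<rho> j \<le> R" if "0 \<le> j" for j using \<rho>_le[OF that] by (simp add: R_def)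
    have c: "\<gamma> ?k * P (?k - 1) \<le> (R + 1) * d (?k - 1) * norm (x (?k - 1) - z)"
      using cost_le[OF z, of "?k - 1" R] \<rho>R[of ?k] k by simp
    have "d (?k - 1) \<le> 2 * B"
      using norm_triangle_ineq4[of "x (?k - 1)" "x (?k - 1 - 1)"] B[of "?k - 1"] B[of "?k - 1 - 1"] k by simp
    then have "(R + 1) * d (?k - 1) * norm (x (?k - 1) - z) \<le> (R + 1) * (2 * B) * norm (x (?k - 1) - z)"
      by (intro mult_right_mono mult_left_mono) (auto simp: R_def)
    with c have "R\<^sup>2 * (\<gamma> ?k * P (?k - 1)) \<le> R\<^sup>2 * ((R + 1) * (2 * B) * norm (x (?k - 1) - z))"
      by (intro mult_left_mono) auto
    moreover have "(\<rho> (?k + 1))\<^sup>2 * (\<gamma> ?k * P (?k - 1)) \<le> R\<^sup>2 * (\<gamma> ?k * P (?k - 1))"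
      using \<rho>R[of "?k + 1"] \<rho>_pos[of "?k + 1"] \<gamma>_pos[of ?k] P_nonneg[of "?k - 1"] k
      by (intro mult_right_mono power_mono) auto
    moreover have "(\<rho> (?k + 1))\<^sup>2 * curv F x \<gamma> ?k * (d ?k)\<^sup>2 \<le> 1/4 * (d ?k)\<^sup>2"
      using \<rho>_bounds(2)[of ?k] k by (intro mult_right_mono) auto
    ultimately show ?thesis using main_descent[OF z k] unfolding W_def by (simp add: mult.assoc)
  qed
  then have "\<forall>\<^sub>F n in sequentially. U z (r n + 1) \<le> W n"
    using r[unfolded filterlim_at_top, rule_format, of 1] by (auto elim: eventually_mono)
  moreover have r1: "filterlim (\<lambda>n. r n + 1) at_top sequentially"
    using r by (rule filterlim_at_top_mono) auto
  ultimately have "l \<le> 0"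
    using tendsto_le[OF sequentially_bot W filterlim_compose[OF l r1]] by simp
  moreover have "0 \<le> l"
    by (rule tendsto_lowerbound[OF l])
      (auto simp: eventually_at_top_linorder intro!: exI[of _ 1] U_nonneg)
  ultimately have l': "((\<lambda>k. sqrt (2 * U z k)) \<longlongrightarrow> 0) at_top"
    using tendsto_real_sqrt[OF tendsto_mult_left[OF l, of 2]] by simp
  have "\<forall>\<^sub>F k in at_top. norm (x k - z) \<le> sqrt (2 * U z k)"
    using eventually_ge_at_top[of 1]
    by eventually_elim (rule real_le_rsqrt, use U_ge_norm[of _ z] in force)
  then show ?thesis
    by (intro LIM_zero_cancel[OF Lim_null_comparison[OF _ l']])
qed

text \<open>Nonexpansiveness of the proximal mapping, with \<open>z\<close> as its fixed point: add
  the subgradient inequalities of \<open>g\<close> at \<open>x k\<close> and at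
  \<open>z\<close>.\<close>

lemma forward_backward_estimate:
  assumes z: "z \<in> argmin \<phi>" and k: "0 \<le> k"
  shows "norm (x k - z) \<le> norm (x (k - 1) - z) + \<gamma> k * norm (F (x (k - 1)) - F z)"
proof -
  let ?a = "x (k - 1) - z" and ?b = "x k - z" and ?c = "F (x (k - 1)) - F z"
  have gk: "0 < \<gamma> k" using \<gamma>_pos k by simp
  have "\<gamma> k * (gr z - inner (F z) (x k - z)) \<le> \<gamma> k * gr (x k)"
    using argmin_subgradient[OF z, of "x k"] k gk by (intro mult_left_mono) (auto simp: g_iter)
  then have "inner ?b ?b \<le> inner (?a - \<gamma> k *\<^sub>R ?c) ?b"
    using iter_subgradient[OF k, of z] z
    by (simp add: g_argmin inner_diff_left inner_diff_right algebra_simps inner_commute)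
  also have "\<dots> \<le> norm (?a - \<gamma> k *\<^sub>R ?c) * norm ?b" by (rule norm_cauchy_schwarz)
  also have "\<dots> \<le> (norm ?a + \<gamma> k * norm ?c) * norm ?b"
    using norm_triangle_ineq4[of ?a "\<gamma> k *\<^sub>R ?c"] gk by (intro mult_right_mono) auto
  finally have "norm ?b * norm ?b \<le> (norm ?a + \<gamma> k * norm ?c) * norm ?b"
    by (simp add: norm_eq_sqrt_inner)
  then show ?thesis using gk
    by (cases "norm ?b = 0") (auto dest: mult_right_le_imp_le)
qed

lemma isCont_F: "isCont F z"
proof -
  obtain L where "L-lipschitz_on (cball z 1) F"
    using lip[unfolded locally_Lipschitz_def, rule_format, of "cball z 1"] by auto
  then have "continuous_on (ball z 1) F"
    using lipschitz_on_continuous_on continuous_on_subset ball_subset_cball by blast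
  then show ?thesis by (simp add: continuous_on_eq_continuous_at)
qed

lemma convergent_subsequence:
  assumes r: "filterlim r at_top sequentially"
  obtains s z where "strict_mono s" "(\<lambda>n. x (r (s n))) \<longlonglongrightarrow> z"
proof -
  have "\<forall>\<^sub>F n in sequentially. -1 \<le> r n" using r by (simp add: filterlim_at_top)
  then obtain n0 where n0: "\<And>n. n0 \<le> n \<Longrightarrow> -1 \<le> r n" by (auto simp: eventually_sequentially)
  then have "bounded (range (\<lambda>n. x (r (n + n0))))"
    by (intro bounded_subset[OF bounded_iterates]) auto
  from bounded_imp_convergent_subsequence[OF this]
  obtain z s where s: "strict_mono s" "((\<lambda>n. x (r (n + n0))) \<circ> s) \<longlonglongrightarrow> z" by blast
  then show ?thesis
    by (intro that[of "\<lambda>n. s n + n0"]) (auto simp: strict_mono_def o_def)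
qed

text \<open>
  A subsequence along which two consecutive iterates approach the same minimizer is found as
  follows.  If the stepsizes are bounded, \<open>rate\<close> yields a subsequence with vanishing cost, and the
  next iterate follows by nonexpansiveness of the proximal mapping.  Otherwise, boundedness of
  \<open>\<gamma>\<^sub>k P\<^sub>k\<^sub>-\<^sub>1\<close> and of \<open>\<rho>\<^sub>k\<close> makes the cost vanish at two consecutive iterates
  along indices with \<open>\<gamma>\<^sub>k \<rightarrow> \<infinity>\<close>, and minimizers that are cluster points are unique.
\<close>

lemma convergence:
  assumes \<epsilon>: "0 < \<epsilon>" "\<And>k. 0 \<le> k \<Longrightarrow> \<epsilon> \<le> \<gamma> k"
  shows "\<exists>z\<in>argmin \<phi>. (x \<longlongrightarrow> z) at_top"
proof (cases "\<exists>M. \<forall>k\<ge>0. \<gamma> k \<le> M")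
  case True
  then obtain M where M: "\<And>k. 0 \<le> k \<Longrightarrow> \<gamma> k \<le> M" by auto
  obtain z0 where z0: "z0 \<in> argmin \<phi>" using ne by auto
  \<comment> \<open>If the cost stayed above \<open>c\<close> from \<open>N\<close> on,
    \<open>rate\<close> would bound every multiple of \<open>c * \<epsilon>\<close> by
    \<open>U z0 (N + 1)\<close>.\<close>
  have ex: "\<exists>k\<ge>N. P k < c" if "0 \<le> N" "0 < c" for N c
  proof (rule ccontr)
    assume "\<not> ?thesis"
    then have c: "c \<le> P j" if "N \<le> j" for j using that by force
    obtain n :: nat where n: "U z0 (N + 1) < real n * (c * \<epsilon>)"
      using reals_Archimedean3[of "c * \<epsilon>"] \<open>0 < c\<close> \<epsilon> by auto
    have "real n * \<epsilon> \<le> (\<Sum>k = N + 1..N + int n + 1. \<epsilon>)" using \<epsilon> by (simp add: algebra_simps)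
    also have "\<dots> \<le> (\<Sum>k = N + 1..N + int n + 1. \<gamma> k)"
      using \<epsilon> \<open>0 \<le> N\<close> by (intro sum_mono) auto
    finally have "c * (real n * \<epsilon>) \<le> c * (\<Sum>k = N + 1..N + int n + 1. \<gamma> k)"
      using \<open>0 < c\<close> by simp
    also have "\<dots> \<le> U z0 (N + 1)"
      using rate[OF z0, of N "N + int n" c] c that by simp
    finally show False using n by (simp add: algebra_simps)
  qed
  have "\<exists>k. int n \<le> k \<and> P k < 1 / real (Suc n)" for n using ex[of "int n" "1 / real (Suc n)"] by simp
  then obtain r where r: "\<And>n. int n \<le> r n" "\<And>n. P (r n) < 1 / real (Suc n)" by metis
  have rt: "filterlim r at_top sequentially"
    using filterlim_int_sequentially r(1) by (auto intro: filterlim_at_top_mono)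
  have "P (r n) \<ge> 0" for n using r(1)[of n] by (intro P_nonneg) simp
  then have P0: "(\<lambda>n. P (r n)) \<longlonglongrightarrow> 0"
    using r(2) by (intro tendsto_sandwich[OF _ _ tendsto_const LIMSEQ_Suc[OF lim_1_over_n]])
      (auto intro!: always_eventually less_imp_le)
  obtain s z where s: "strict_mono s" "(\<lambda>n. x (r (s n))) \<longlonglongrightarrow> z"
    using convergent_subsequence[OF rt] .
  have st: "filterlim (\<lambda>n. r (s n)) at_top sequentially"
    using filterlim_compose[OF rt filterlim_subseq[OF s(1)]] .
  have z: "z \<in> argmin \<phi>"
    using optimal_cluster_point[OF st _ s(2)] LIMSEQ_subseq_LIMSEQ[OF P0 s(1)] by (simp add: o_def)
  have e: "norm (x (r (s n) + 1) - z) \<le> norm (x (r (s n)) - z) + M * norm (F (x (r (s n))) - F z)" for n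
  proof -
    have k: "0 \<le> r (s n)" using r(1)[of "s n"] by simp
    have "\<gamma> (r (s n) + 1) * norm (F (x (r (s n))) - F z) \<le> M * norm (F (x (r (s n))) - F z)"
      using M[of "r (s n) + 1"] k by (intro mult_right_mono) auto
    then show ?thesis using forward_backward_estimate[OF z, of "r (s n) + 1"] k by simp
  qed
  have "(\<lambda>n. norm (x (r (s n)) - z) + M * norm (F (x (r (s n))) - F z)) \<longlonglongrightarrow> norm (z - z) + M * norm (F z - F z)"
    by (intro tendsto_intros s(2) isCont_tendsto_compose[OF isCont_F])
  then have "(\<lambda>n. norm (x (r (s n)) - z) + M * norm (F (x (r (s n))) - F z)) \<longlonglongrightarrow> 0" by simp
  then have "(\<lambda>n. x (r (s n) + 1) - z) \<longlonglongrightarrow> 0"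
    by (rule Lim_null_comparison[rotated]) (use e in auto)
  then have l: "(\<lambda>n. x (r (s n) + 1)) \<longlonglongrightarrow> z" by (rule LIM_zero_cancel)
  have "filterlim (\<lambda>n. r (s n) + 1) at_top sequentially"
    using st by (rule filterlim_at_top_mono) auto
  from converges_if_consecutive[OF z this l] s(2) z show ?thesis by auto
next
  case False
  define R where "R = max 2 (\<rho> 0)"
  obtain z0 where z0: "z0 \<in> argmin \<phi>" using ne by auto
  have big: "\<exists>k\<ge>int n. real n + 1 < \<gamma> k" for n
  proof (rule ccontr)
    assume a: "\<not> ?thesis"
    \<comment> \<open>Were no late stepsize large, the finitely many early ones would yield a global
      bound.\<close>
    have "\<gamma> k \<le> max (real n + 1) (Max (\<gamma> ` {0..int n}))" if "0 \<le> k" for k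
    proof (cases "k \<le> int n")
      case True
      then show ?thesis using that by (intro max.coboundedI2 Max_ge) auto
    next
      case False
      then have "\<gamma> k \<le> real n + 1" using a by (meson linorder_linear linorder_not_less)
      then show ?thesis by simp
    qed
    with False show False by blast
  qed
  then obtain r where r: "\<And>n. int n \<le> r n" "\<And>n. real n + 1 < \<gamma> (r n)" by metis
  have \<gamma>P: "\<gamma> k * P (k - 1) \<le> U z0 1" if "1 \<le> k" for k
  proof -
    have "0 \<le> \<gamma> k * \<rho> k * P (k - 1)"
      using \<gamma>_pos[of k] \<rho>_pos[of k] P_nonneg[of "k - 1"] that by (intro mult_nonneg_nonneg) auto
    then show ?thesis using U_ge_cost[of k z0] U_le_U1[OF z0 that] by (simp add: algebra_simps)
  qed
  have st: "filterlim (\<lambda>n. r n - c) at_top sequentially" for c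
  proof -
    have "Z \<le> r n - c" if "nat (Z + c) \<le> n" for Z n using r(1)[of n] that by linarith
    then show ?thesis unfolding filterlim_at_top eventually_sequentially by blast
  qed
  have lim: "(\<lambda>n. C / real (Suc n)) \<longlonglongrightarrow> 0" for C
    using tendsto_mult_left[OF LIMSEQ_Suc[OF lim_1_over_n], of C] by simp
  have r2: "\<forall>\<^sub>F n in sequentially. 2 \<le> r n"
    using st[of 0] by (simp add: filterlim_at_top)
  have b: "0 \<le> P (r n - 1)" "P (r n - 1) \<le> U z0 1 / real (Suc n)"
    "0 \<le> P (r n - 2)" "P (r n - 2) \<le> R * U z0 1 / real (Suc n)" if "2 \<le> r n" for n
  proof -
    let ?k = "r n"
    show p: "0 \<le> P (?k - 1)" "0 \<le> P (?k - 2)" using that by (auto intro: P_nonneg)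
    have "real (Suc n) * P (?k - 1) \<le> \<gamma> ?k * P (?k - 1)"
      using r(2)[of n] p by (intro mult_right_mono) auto
    then have "real (Suc n) * P (?k - 1) \<le> U z0 1" using \<gamma>P[of ?k] that by simp
    then show "P (?k - 1) \<le> U z0 1 / real (Suc n)" by (simp add: pos_le_divide_eq mult.commute)
    \<comment> \<open>Since ratios are bounded, the preceding stepsize is large too, which makes the
      cost one index earlier small.\<close>
    have "\<gamma> ?k \<le> R * \<gamma> (?k - 1)"
      using \<gamma>_Suc[of "?k - 1"] \<rho>_le[of ?k] \<gamma>_pos[of "?k - 1"] that
      by (auto simp: R_def intro: mult_right_mono)
    then have "real (Suc n) * P (?k - 2) \<le> R * \<gamma> (?k - 1) * P (?k - 2)"
      using r(2)[of n] p by (intro mult_right_mono) auto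
    also have "\<dots> \<le> R * U z0 1"
      using \<gamma>P[of "?k - 1"] that by (simp add: R_def mult.assoc mult_left_mono)
    finally show "P (?k - 2) \<le> R * U z0 1 / real (Suc n)" by (simp add: pos_le_divide_eq mult.commute)
  qed
  have P1: "(\<lambda>n. P (r n - 1)) \<longlonglongrightarrow> 0"
    by (rule tendsto_sandwich[OF _ _ tendsto_const lim[of "U z0 1"]]) (use b r2 in \<open>auto elim!: eventually_mono\<close>)
  have P2: "(\<lambda>n. P (r n - 2)) \<longlonglongrightarrow> 0"
    by (rule tendsto_sandwich[OF _ _ tendsto_const lim[of "R * U z0 1"]]) (use b r2 in \<open>auto elim!: eventually_mono\<close>)
  obtain s z where s: "strict_mono s" "(\<lambda>n. x (r (s n) - 1)) \<longlonglongrightarrow> z"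
    using convergent_subsequence[OF st[of 1]] .
  have st': "filterlim (\<lambda>n. r (s n) - c) at_top sequentially" for c
    using filterlim_compose[OF st filterlim_subseq[OF s(1)]] .
  \<comment> \<open>A second extraction, so that \<open>x (r n - 1)\<close> and
    \<open>x (r n - 2)\<close> converge along a common subsequence.\<close>
  obtain t z' where t: "strict_mono t" "(\<lambda>n. x (r (s (t n)) - 2)) \<longlonglongrightarrow> z'"
    using convergent_subsequence[OF st'[of 2]] .
  have st'': "filterlim (\<lambda>n. r (s (t n)) - c) at_top sequentially" for c
    using filterlim_compose[OF st' filterlim_subseq[OF t(1)]] .
  have sub: "strict_mono (\<lambda>n. s (t n))" using s(1) t(1) by (simp add: strict_mono_def)
  have l1: "(\<lambda>n. x (r (s (t n)) - 1)) \<longlonglongrightarrow> z"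
    using LIMSEQ_subseq_LIMSEQ[OF s(2) t(1)] by (simp add: o_def)
  have z: "z \<in> argmin \<phi>"
    using optimal_cluster_point[OF st'' _ l1] LIMSEQ_subseq_LIMSEQ[OF P1 sub] by (simp add: o_def)
  have z': "z' \<in> argmin \<phi>"
    using optimal_cluster_point[OF st'' _ t(2)] LIMSEQ_subseq_LIMSEQ[OF P2 sub] by (simp add: o_def)
  have "z = z'"
    by (rule optimal_cluster_point_unique[OF z z' st'' l1 st'' t(2)])
  with t(2) have "(\<lambda>n. x (r (s (t n)) - 1 - 1)) \<longlonglongrightarrow> z" by simp
  from converges_if_consecutive[OF z st''[of 1] l1 this] z show ?thesis by blast
qed


section \<open>Lower bounds for the stepsizes of the exact rule\<close>

text \<open>If the second term of the minimum is active, \<open>curv\<close> is below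
  \<open>(\<gamma> k * L)\<^sup>2\<close>. Strictness comes from dropping
  \<open>\<gamma> k * Is k\<close>, which is positive in this case.\<close>

lemma stepsize_cases:
  assumes k: "0 \<le> k" and eq: "ereal (\<gamma> (k + 1)) = step_bound F x \<gamma> k"
    and L: "0 < L" "norm (dF k) \<le> L * norm (dx k)"
  shows "1 / (2 * L) < \<gamma> (k + 1) \<or> \<gamma> (k + 1) = \<gamma> k * sqrt (1 + \<rho> k)"
proof (rule disjCI)
  let ?s = "curv F x \<gamma> k"
  assume "\<gamma> (k + 1) \<noteq> \<gamma> k * sqrt (1 + \<rho> k)"
  with eq have s: "0 < ?s" and gk1: "\<gamma> (k + 1) = \<gamma> k * (1 / (2 * sqrt ?s))"
    unfolding step_bound_eq by (auto simp: min_def split: if_splits)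
  have gk: "0 < \<gamma> k" using \<gamma>_pos k by simp
  have "ell F x k \<noteq> 0" using s by auto
  then have "Is k \<noteq> 0" "dx k \<noteq> 0" by (auto simp: ell_def)
  then have I: "0 < Is k" and D: "0 < (norm (dx k))\<^sup>2"
    using F_monotone[of "x (k - 1)" "x k"] by auto
  have "(norm (dF k))\<^sup>2 \<le> (L * norm (dx k))\<^sup>2" using L by (intro power_mono) auto
  then have "(\<gamma> k)\<^sup>2 * (norm (dF k))\<^sup>2 \<le> (\<gamma> k)\<^sup>2 * (L * norm (dx k))\<^sup>2" by (intro mult_left_mono) auto
  moreover have "0 < \<gamma> k * Is k" using gk I by simp
  ultimately have "?s * (norm (dx k))\<^sup>2 < (\<gamma> k)\<^sup>2 * (L * norm (dx k))\<^sup>2"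
    unfolding curv_eq by linarith
  also have "\<dots> = (\<gamma> k * L)\<^sup>2 * (norm (dx k))\<^sup>2" by (simp only: power_mult_distrib mult.assoc)
  finally have "?s < (\<gamma> k * L)\<^sup>2" by (rule mult_right_less_imp_less) simp
  then have "sqrt ?s < \<gamma> k * L" using gk L by (intro real_less_lsqrt) auto
  moreover have "0 < sqrt ?s" using s by simp
  ultimately show "1 / (2 * L) < \<gamma> (k + 1)"
    unfolding gk1 using gk L by (simp add: field_simps del: real_sqrt_gt_0_iff)
qed

text \<open>Until \<open>1 / (2 * L)\<close> is exceeded, the ratio is at least 1 and each step
  multiplies the stepsize by at least \<open>sqrt 2\<close>; afterwards the square-root branch only
  increases it and the other branch exceeds the bound anew. The index is strictly above the
  threshold: if \<open>2 * \<gamma> 0 * L = 1\<close>, the threshold is 0 and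
  \<open>\<gamma> 0\<close> equals \<open>1 / (2 * L)\<close>.\<close>

lemma stepsize_lower_bound:
  assumes eq: "\<And>k. 0 \<le> k \<Longrightarrow> ereal (\<gamma> (k + 1)) = step_bound F x \<gamma> k"
    and init: "\<gamma> (-1) \<le> \<gamma> 0" and L: "0 < L" "L-lipschitz_on V F" and V: "x ` {-1..} \<subseteq> V"
    and k: "max \<lfloor>2 * log 2 (1 / (2 * \<gamma> 0 * L))\<rfloor> 0 < k"
  shows "1 / (2 * L) < \<gamma> k"
proof -
  have "1 / (2 * L) < \<gamma> j \<or> \<gamma> 0 * 2 powr (real_of_int j / 2) \<le> \<gamma> j \<and> 1 \<le> \<rho> j" if "0 \<le> j" for j
    using that
  proof (induction rule: int_ge_induct)
    case base
    show ?case using init \<gamma>_pos[of "-1"] by (simp add: step_ratio_def)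
  next
    case (step j)
    have p: "0 < \<gamma> j" "0 < \<rho> j" using \<gamma>_pos \<rho>_pos step by auto
    have "norm (dF j) \<le> L * norm (dx j)"
      using lipschitz_onD[OF L(2), of "x (j - 1)" "x j"] V step.hyps by (simp add: dist_norm image_subset_iff)
    from stepsize_cases[OF step.hyps eq[OF step.hyps] L(1) this]
    show ?case
    proof
      assume e: "\<gamma> (j + 1) = \<gamma> j * sqrt (1 + \<rho> j)"
      from step.IH show ?thesis
      proof
        assume "1 / (2 * L) < \<gamma> j"
        also have "\<gamma> j * 1 \<le> \<gamma> (j + 1)" unfolding e using p by (intro mult_left_mono) auto
        finally show ?thesis by simp
      next
        assume h: "\<gamma> 0 * 2 powr (real_of_int j / 2) \<le> \<gamma> j \<and> 1 \<le> \<rho> j"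
        then have s2: "sqrt 2 \<le> sqrt (1 + \<rho> j)" by simp
        have "\<gamma> 0 * 2 powr (real_of_int (j + 1) / 2) = \<gamma> 0 * 2 powr (real_of_int j / 2) * sqrt 2"
          by (simp add: add_divide_distrib powr_add powr_half_sqrt)
        also have "\<dots> \<le> \<gamma> j * sqrt (1 + \<rho> j)"
          using h s2 p \<gamma>_pos[of 0] by (intro mult_mono) auto
        finally have "\<gamma> 0 * 2 powr (real_of_int (j + 1) / 2) \<le> \<gamma> (j + 1)" by (simp only: e)
        moreover have "1 \<le> \<rho> (j + 1)"
          using p unfolding step_ratio_def[of \<gamma> "j + 1"] e by simp
        ultimately show ?thesis by blast
      qed
    qed simp
  qed
  then have "1 / (2 * L) < \<gamma> k \<or> \<gamma> 0 * 2 powr (real_of_int k / 2) \<le> \<gamma> k \<and> 1 \<le> \<rho> k"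
    using k by simp
  then show ?thesis
  proof
    assume h: "\<gamma> 0 * 2 powr (real_of_int k / 2) \<le> \<gamma> k \<and> 1 \<le> \<rho> k"
    have g0: "0 < \<gamma> 0" using \<gamma>_pos by simp
    \<comment> \<open>Being an integer above the floor, \<open>k\<close> exceeds the logarithm
      itself; equality with the floor would not suffice.\<close>
    have "2 * log 2 (1 / (2 * \<gamma> 0 * L)) < real_of_int k" using k by (simp add: floor_less_iff)
    then have "1 / (2 * \<gamma> 0 * L) < 2 powr (real_of_int k / 2)"
      using g0 L by (subst log_less_iff[symmetric]) auto
    then have "\<gamma> 0 * (1 / (2 * \<gamma> 0 * L)) < \<gamma> 0 * 2 powr (real_of_int k / 2)"
      by (rule mult_strict_left_mono[OF _ g0])
    then show ?thesis using h g0 by simp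
  qed
qed

text \<open>Combines the eventual bound, for a ball containing the iterates, with the minimum of the
  finitely many earlier stepsizes.\<close>

lemma stepsize_bounded_away:
  assumes eq: "\<And>k. 0 \<le> k \<Longrightarrow> ereal (\<gamma> (k + 1)) = step_bound F x \<gamma> k" and init: "\<gamma> (-1) \<le> \<gamma> 0"
  obtains \<epsilon> where "0 < \<epsilon>" "\<And>k. 0 \<le> k \<Longrightarrow> \<epsilon> \<le> \<gamma> k"
proof -
  obtain B where B: "x ` {-1..} \<subseteq> cball 0 B"
    using bounded_iterates by (auto simp: bounded_iff image_subset_iff)
  obtain L where L: "0 < L" "L-lipschitz_on (cball 0 B) F"
    using lip[unfolded locally_Lipschitz_def, rule_format, of "cball 0 B"] by auto
  define k0 where "k0 = max \<lfloor>2 * log 2 (1 / (2 * \<gamma> 0 * L))\<rfloor> 0"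
  define \<epsilon> where "\<epsilon> = min (1 / (2 * L)) (Min (\<gamma> ` {0..k0}))"
  have ne: "{0..k0} \<noteq> {}" by (auto simp: k0_def)
  show ?thesis
  proof
    show "0 < \<epsilon>" using ne \<gamma>_pos L by (auto simp: \<epsilon>_def Min_gr_iff)
    fix k :: int assume "0 \<le> k"
    show "\<epsilon> \<le> \<gamma> k"
    proof (cases "k \<le> k0")
      case True
      then have "Min (\<gamma> ` {0..k0}) \<le> \<gamma> k" using \<open>0 \<le> k\<close> by (intro Min_le) auto
      then show ?thesis by (simp add: \<epsilon>_def)
    next
      case False
      then have "1 / (2 * L) < \<gamma> k"
        using stepsize_lower_bound[OF eq init L B, of k] by (simp add: k0_def not_le)
      then show ?thesis by (simp add: \<epsilon>_def)
    qed
  qed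
qed

section \<open>Transfer to extended reals and the final assembly\<close>

lemma cost_gap_eq: "0 \<le> k \<Longrightarrow> cost_gap \<phi> x k = ereal (P k)"
  by (simp add: cost_gap_def INF_m g_iter P_def)

lemma merit_eq: "1 \<le> k \<Longrightarrow> merit \<phi> x \<gamma> z k = ereal (U z k)"
  by (simp add: merit_def cost_gap_eq U_def)

lemma MIN_cost_gap: "(MIN k\<in>{0..int K}. cost_gap \<phi> x k) = ereal (MIN k\<in>{0..int K}. P k)"
proof -
  have "(MIN k\<in>{0..int K}. cost_gap \<phi> x k) = (MIN k\<in>{0..int K}. ereal (P k))"
    by (intro arg_cong[of _ _ Min] image_cong) (auto simp: cost_gap_eq)
  also have "\<dots> = ereal (MIN k\<in>{0..int K}. P k)"
    using mono_Min_commute[of ereal "P ` {0..int K}"] by (simp add: image_image mono_def)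
  finally show ?thesis .
qed

lemma best_cost_le:
  assumes "z \<in> argmin \<phi>"
  shows "(MIN k\<in>{0..int K}. P k) * (\<Sum>k = 1..int K + 1. \<gamma> k) \<le> U z 1"
proof -
  have "0 \<le> (MIN k\<in>{0..int K}. P k)" by (subst Min_ge_iff) (auto intro: P_nonneg)
  then show ?thesis using rate[OF assms, of 0 "int K" "MIN k\<in>{0..int K}. P k"] by simp
qed

lemma best_cost_bigo:
  assumes \<epsilon>: "0 < \<epsilon>" "\<And>k. 0 \<le> k \<Longrightarrow> \<epsilon> \<le> \<gamma> k"
  shows "(\<lambda>K::nat. MIN k\<in>{0..int K}. P k) \<in> O(\<lambda>K. 1 / real K)"
proof -
  obtain z where z: "z \<in> argmin \<phi>" using ne by auto
  have "norm (MIN k\<in>{0..int K}. P k) \<le> U z 1 / \<epsilon> * norm (1 / real K)" if "1 \<le> K" for K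
  proof -
    let ?c = "MIN k\<in>{0..int K}. P k"
    have c: "0 \<le> ?c" by (subst Min_ge_iff) (auto intro: P_nonneg)
    \<comment> \<open>The sum has \<open>K + 1\<close> terms; one is given away to match
      \<open>1 / real K\<close>.\<close>
    have "real K * \<epsilon> \<le> (\<Sum>k = 1..int K + 1. \<epsilon>)" using \<epsilon> by simp
    also have "\<dots> \<le> (\<Sum>k = 1..int K + 1. \<gamma> k)" using \<epsilon> by (intro sum_mono) auto
    finally have "?c * (real K * \<epsilon>) \<le> ?c * (\<Sum>k = 1..int K + 1. \<gamma> k)"
      using c by (intro mult_left_mono) auto
    then have "?c * (real K * \<epsilon>) \<le> U z 1" using best_cost_le[OF z, of K] by linarith
    then show ?thesis using c \<epsilon> that by (simp add: field_simps)
  qed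
  then show ?thesis
    by (intro bigoI[of _ "U z 1 / \<epsilon>"]) (auto simp: eventually_sequentially)
qed

end

text \<open>Supplies the positivity required by the locale for the exact rule, where only
  \<open>\<gamma> (-1)\<close> is assumed positive.\<close>

lemma step_bound_pos:
  assumes "0 < \<gamma> k" "0 < \<gamma> (k - 1)" "ereal c = step_bound F x \<gamma> k"
  shows "0 < c"
proof -
  have "0 < sqrt (1 + step_ratio \<gamma> k)" using assms by (simp add: step_ratio_def add_pos_pos)
  then show ?thesis using assms unfolding step_bound_eq by (auto simp: min_def)
qed

theorem theorem2p3:
  fixes f :: "real ^ 'n \<Rightarrow> real"
    and F :: "real ^ 'n \<Rightarrow> real ^ 'n"
    and g \<phi> :: "real ^ 'n \<Rightarrow> ereal"
    and x :: "int \<Rightarrow> real ^ 'n"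
    and \<gamma> :: "int \<Rightarrow> real"
    and xs :: "real ^ 'n"
  defines "\<phi> \<equiv> \<lambda>w. ereal (f w) + g w"
  assumes "convex_on UNIV f"
    and "\<And>w. GDERIV f w :> F w"
    and "locally_Lipschitz F"
    and "proper g" and "lsc g" and "econvex g"
    and "argmin \<phi> \<noteq> {}"
    and "adaPGM F g x \<gamma>"
    and "xs \<in> argmin \<phi>"
  shows
    \<comment> \<open>(i)\<close>
    "(\<forall>k\<ge>1.
        merit \<phi> x \<gamma> xs (k + 1)
          \<le> merit \<phi> x \<gamma> xs k
            - ereal ((1/4 - (step_ratio \<gamma> (k + 1))\<^sup>2 * \<gamma> k * ell F x k * (\<gamma> k * cc F x k - 1))
                     * (norm (x (k - 1) - x k))\<^sup>2)
            - ereal (\<gamma> k * (1 + step_ratio \<gamma> k - (step_ratio \<gamma> (k + 1))\<^sup>2)) * cost_gap \<phi> x (k - 1)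
        \<and> 1/4 - (step_ratio \<gamma> (k + 1))\<^sup>2 * \<gamma> k * ell F x k * (\<gamma> k * cc F x k - 1) \<ge> 0
        \<and> 1 + step_ratio \<gamma> k - (step_ratio \<gamma> (k + 1))\<^sup>2 \<ge> 0)
     \<and>
     \<comment> \<open>(ii)\<close>
     (bounded (x ` {-1..})
      \<and> (\<forall>V L. convex V \<and> compact V \<and> x ` {-1..} \<subseteq> V \<and> L > 0 \<and> L-lipschitz_on V F \<longrightarrow>
           (\<forall>k > max \<lfloor>2 * log 2 (1 / (2 * \<gamma> 0 * L))\<rfloor> 0. \<gamma> k > 1 / (2 * L))))
     \<and>
     \<comment> \<open>(iii)\<close>
     ((\<exists>z\<in>argmin \<phi>. (\<lambda>k::nat. x (int k)) \<longlonglongrightarrow> z)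
      \<and> (\<forall>y \<delta>. relaxed_adaPGM F g y \<delta> \<and> (\<exists>\<epsilon>>0. \<forall>k\<ge>0. \<delta> k \<ge> \<epsilon>) \<longrightarrow>
           (\<exists>z\<in>argmin \<phi>. (\<lambda>k::nat. y (int k)) \<longlonglongrightarrow> z)))
     \<and>
     \<comment> \<open>(iv)\<close>
     ((\<forall>K::nat. (MIN k\<in>{0..int K}. cost_gap \<phi> x k)
                  \<le> merit \<phi> x \<gamma> xs 1 / ereal (\<Sum>k = 1..int K + 1. \<gamma> k))
      \<and> (\<lambda>K::nat. real_of_ereal (MIN k\<in>{0..int K}. cost_gap \<phi> x k)) \<in> O(\<lambda>K. 1 / real K))"
proof -
  have init: "0 < \<gamma> (-1)" "\<gamma> (-1) \<le> \<gamma> 0"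
    and iter: "prox_grad_iterates F g x \<gamma>"
    and eq: "ereal (\<gamma> (k + 1)) = step_bound F x \<gamma> k" if "0 \<le> k" for k
    using \<open>adaPGM F g x \<gamma>\<close> that by (auto simp: adaPGM_def)
  \<comment> \<open>Induction on consecutive pairs, because the rule refers to the two preceding
    stepsizes.\<close>
  have pos2: "0 < \<gamma> (k - 1) \<and> 0 < \<gamma> k" if "0 \<le> k" for k
    using that
  proof (induction rule: int_ge_induct)
    case base then show ?case using init[of 0] by simp
  next
    case (step k)
    then show ?case using step_bound_pos[OF _ _ eq] by simp
  qed
  have pos: "0 < \<gamma> k" if "-1 \<le> k" for k using pos2[of "k + 1"] that by simp
  interpret adaptive_prox_grad f F g x \<gamma>
    using assms(2-8) iter[of 0] pos eq unfolding \<phi>_def by unfold_locales auto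
  have xs: "xs \<in> argmin (\<lambda>w. ereal (f w) + g w)" using assms(10) by (simp add: \<phi>_def)
  obtain \<epsilon> where \<epsilon>: "0 < \<epsilon>" "\<And>k. 0 \<le> k \<Longrightarrow> \<epsilon> \<le> \<gamma> k"
    using stepsize_bounded_away[OF eq init(2)[of 0]] by auto
  have "merit \<phi> x \<gamma> xs (k + 1)
          \<le> merit \<phi> x \<gamma> xs k
            - ereal ((1/4 - (step_ratio \<gamma> (k + 1))\<^sup>2 * \<gamma> k * ell F x k * (\<gamma> k * cc F x k - 1))
                     * (norm (x (k - 1) - x k))\<^sup>2)
            - ereal (\<gamma> k * (1 + step_ratio \<gamma> k - (step_ratio \<gamma> (k + 1))\<^sup>2)) * cost_gap \<phi> x (k - 1)
        \<and> 1/4 - (step_ratio \<gamma> (k + 1))\<^sup>2 * \<gamma> k * ell F x k * (\<gamma> k * cc F x k - 1) \<ge> 0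
        \<and> 1 + step_ratio \<gamma> k - (step_ratio \<gamma> (k + 1))\<^sup>2 \<ge> 0" if "1 \<le> k" for k
    using descent[OF xs that] \<rho>_bounds[of k] that unfolding \<phi>_def
    by (simp add: merit_eq cost_gap_eq norm_minus_commute[of "x (k - 1)"] mult.assoc)
  moreover have "1 / (2 * L) < \<gamma> k"
    if "x ` {-1..} \<subseteq> V" "L > 0" "L-lipschitz_on V F" "max \<lfloor>2 * log 2 (1 / (2 * \<gamma> 0 * L))\<rfloor> 0 < k" for V L k
    using stepsize_lower_bound[OF eq init(2)[of 0] that(2,3,1,4)] by simp
  moreover have "\<exists>z\<in>argmin \<phi>. (\<lambda>k::nat. x (int k)) \<longlonglongrightarrow> z"
    using convergence[OF \<epsilon>] filterlim_compose[OF _ filterlim_int_sequentially] unfolding \<phi>_def by blast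
  moreover have "\<exists>z\<in>argmin \<phi>. (\<lambda>k::nat. y (int k)) \<longlonglongrightarrow> z"
    if y: "relaxed_adaPGM F g y \<delta>" and e: "e > 0" "\<And>k. 0 \<le> k \<Longrightarrow> e \<le> \<delta> k" for y \<delta> e
  proof -
    \<comment> \<open>The relaxed rule does not bound stepsizes from below; positivity comes from
      \<open>e\<close>, and at index -1 from the initial condition.\<close>
    have "0 < \<delta> k" if "-1 \<le> k" for k
      using e(1) e(2)[of k] y that by (cases "k = -1") (auto simp: relaxed_adaPGM_def)
    then interpret y: adaptive_prox_grad f F g y \<delta>
      using assms(2-8) y unfolding \<phi>_def relaxed_adaPGM_def by unfold_locales auto
    show ?thesis
      using y.convergence[OF e] filterlim_compose[OF _ filterlim_int_sequentially] unfolding \<phi>_def by blast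
  qed
  moreover have "(MIN k\<in>{0..int K}. cost_gap \<phi> x k) \<le> merit \<phi> x \<gamma> xs 1 / ereal (\<Sum>k = 1..int K + 1. \<gamma> k)" for K
  proof -
    have "0 < (\<Sum>k = 1..int K + 1. \<gamma> k)" by (intro sum_pos pos) auto
    then show ?thesis
      using best_cost_le[OF xs, of K] unfolding \<phi>_def MIN_cost_gap
      by (simp add: merit_eq pos_le_divide_eq)
  qed
  moreover have "(\<lambda>K::nat. real_of_ereal (MIN k\<in>{0..int K}. cost_gap \<phi> x k)) \<in> O(\<lambda>K. 1 / real K)"
    using best_cost_bigo[OF \<epsilon>] unfolding \<phi>_def MIN_cost_gap by simp
  ultimately show ?thesis using bounded_iterates by blast
qed

end
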